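(* Let $\Sigma$ be a finite alphabet. (a) For every residually defined $g$-function $g$ of a property $(D)$ subshift $X\subset\Sigma^{\mathbb Z}$, one has $g_{\mathcal M(g)}=g$ (equality of functions, including equality of the domains). (b) For every residually contractive vertex set $\mathcal M\subset\mathcal M(\Sigma)$, one has $\mathcal M(g_{\mathcal M})=\mathcal M$.
   Context: Subshifts. $S$ is the shift, $(Sx)_i=x_{i+1}$. A subshift is a closed $S$-invariant set $X\subset\Sigma^{\mathbb Z}$; a finite word is admissible if it appears in some point of $X$. For an interval $J\subset\mathbb Z$, $x_J=(x_j)_{j\in J}$ and $X_J=\{x_J:x\in X\}$ with the product topology; blocks are identified with words up to translation of indices. A set is residual if it contains a dense $G_\delta$. For $x^-\in X_{(-\infty,0]}$, $\Gamma_n^+(x^-)$ is the set of words $b$ of length $n$ with $(x^-,b)\in X_{(-\infty,n]}$. For an admissible word $a$, $\Gamma^-(a)$ is the set of finite words $c$ with $ca$ admissible, $\Gamma_\infty^-(a)$ is the set of left-infinite sequences $x^-$ such that $(x^-,a)$ is, up to translation, in $X_{(-\infty,0]}$, and $\omega_n^+(a)$ is the set of words $b$ of length $n$ such that $(x^-,a,b)$ is, up to translation, in $X_{(-\infty,0]}$ for all $x^-\in\Gamma_\infty^-(a)$. Property $(D)$: for every admissible word $b\sigma$ ($\sigma\in\Sigma$) there is $a\in\Gamma^-(b)$ with $\sigma\in\omega_1^+(ab)$. Residually defined $g$-function of $X$: a continuous function $g:D^-(g)\times\Sigma\to[0,1]$, $D^-(g)$ residual in $X_{(-\infty,0]}$,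 such that (i) $\sum_{\sigma\in\Gamma_1^+(x^-)}g(x^-,\sigma)=1$ for $x^-\in D^-(g)$, and $g(x^-,\sigma)=0$ if $\sigma\notin\Gamma_1^+(x^-)$; (ii) there is no point of $X_{(-\infty,0]}\setminus D^-(g)$ to which $x^-\mapsto(g(x^-,\sigma))_{\sigma\in\Sigma}$ can be extended by continuity; (iii) $X_{(-\infty,1]}=\overline{\{(x^-,\alpha):x^-\in D^-(g),\alpha\in\Gamma_1^+(x^-),g(x^-,\alpha)>0\}}$. The Shannon graph $\mathcal M(\Sigma)$. $\mathcal M(\Sigma)$ is the set of Borel probability measures on $\Sigma^{\mathbb N}$ with the weak* topology. For a word $a=a_1\cdots a_n$, $C(a)=\{x\in\Sigma^{\mathbb N}:x_i=a_i,1\le i\le n\}$. For a word $a$ and $\mu\in\mathcal M(\Sigma)$ with $\mu(C(a))>0$, $\tau(a)\mu\in\mathcal M(\Sigma)$ is given by $\tau(a)\mu(C(b))=\mu(C(ab))/\mu(C(a))$ for all words $b$. For $\mathcal M\subset\mathcal M(\Sigma)$, $\tau(a)\mathcal M=\{\tau(a)\mu:\mu\in\mathcal M,\mu(C(a))>0\}$. $\mathcal M$ is transition complete if $\tau(\sigma)\mathcal M\subset\mathcal M$ for all $\sigma\in\Sigma$. Condition (I): $\mathcal M=\overline{\bigcup_{\alpha\in\Sigma}\tau(\alpha)\mathcal M}$. A transition complete $\mathcal M$ with (I) presents a subshift $X^{(\mathcal M)}$, namely the one whose admissible words are exactly the words $a$ with $\mu(C(a))>0$ for some $\mu\in\mathcal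 M$. For $x^-\in X^{(\mathcal M)}_{(-\infty,0]}$ put $\mathcal M(x^-)=\bigcap_{I\in\mathbb N}\overline{\tau(x^-_{(-I,0]})\mathcal M}$. Let $D_n^-(\mathcal M)$ be the set of $x^-\in X^{(\mathcal M)}_{(-\infty,0]}$ such that all $\mu\in\mathcal M(x^-)$ have the same marginal on the coordinates $1,\dots,n$, let $D_\infty^-(\mathcal M)=\bigcap_{n}D_n^-(\mathcal M)$, and for $x^-\in D_\infty^-(\mathcal M)$ let $\mu^{(\mathcal M)}(x^-)$ be the unique element of $\mathcal M(x^-)$. Residually contractive vertex set: a transition complete $\mathcal M\subset\mathcal M(\Sigma)$ satisfying (I) and: (II) $\overline{D_\infty^-(\mathcal M)}=X^{(\mathcal M)}_{(-\infty,0]}$; (III) for $x^-\in X^{(\mathcal M)}_{(-\infty,0]}$ and $\mu\in\mathcal M(x^-)$ there exist $x^-(k)\in D_\infty^-(\mathcal M)$, $k\in\mathbb N$, with $\lim_k x^-(k)=x^-$ and $\lim_k\mu^{(\mathcal M)}(x^-(k))=\mu$. From $\mathcal M$ to $g_{\mathcal M}$. For a residually contractive $\mathcal M$, $g_{\mathcal M}$ is the residually defined $g$-function of $X^{(\mathcal M)}$ with $D^-(g_{\mathcal M})=D_1^-(\mathcal M)$ and $g_{\mathcal M}(x^-,\alpha)=\mu(C(\alpha))$ for $x^-\in D_1^-(\mathcal M)$, $\alpha\in\Sigma$, where $\mu$ is any element of $\mathcal M(x^-)$. From $g$ to $\mathcal M(g)$. Let $g$ be a residually defined $g$-function of a property $(D)$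 subshift $X$. Let $D_\infty^-(g)$ be the set of $x^-\in D^-(g)$ such that for all $k\in\mathbb N$, $a\in\Gamma_k^+(x^-)$, the left-infinite sequence $(x^-,a)$ is, after translation of indices, in $D^-(g)$. For $x^-\in D_\infty^-(g)$ let $\mu_\infty(g)(x^-)\in\mathcal M(\Sigma)$ be given by $\mu_\infty(g)(x^-)(C(a))=\prod_{k=1}^N g((x^-,a_1\cdots a_{k-1}),a_k)$ for $a=a_1\cdots a_N\in\Gamma_N^+(x^-)$ and $\mu_\infty(g)(x^-)(C(a))=0$ for other words $a$. Then $\mathcal M(g)=\overline{\{\mu_\infty(g)(x^-):x^-\in D_\infty^-(g)\}}$; it is a residually contractive vertex set with $X^{(\mathcal M(g))}=X$. *)

theory Defs
  imports "HOL-Probability.Probability"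
begin

text \<open>
  The alphabet is a type \<open>'a::finite\<close>. Bi-infinite sequences are functions on \<open>int\<close>. A left-infinite
  sequence, indexed by \<open>(-\<infinity>, n]\<close>, is a function \<open>x :: nat \<Rightarrow> 'a\<close> read backwards from its right end:
  \<open>x i\<close> is the entry at position \<open>n - i\<close>. This realises the identification of blocks up to
  translation of indices. Sequences in \<open>\<Sigma>\<^sup>\<nat>\<close> are functions \<open>y :: nat \<Rightarrow> 'a\<close> read forwards, with
  coordinate \<open>i\<close> of the paper (counted from 1) stored at \<open>i - 1\<close>. Words are lists.
\<close>

definition seq_topology :: "('i \<Rightarrow> 'a) topology" where
  "seq_topology = product_topology (\<lambda>_. discrete_topology UNIV) UNIV"


subsection \<open>Subshifts\<close>

definition shift :: "(int \<Rightarrow> 'a) \<Rightarrow> (int \<Rightarrow> 'a)" where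
  "shift x = (\<lambda>i. x (i + 1))"

definition subshift :: "(int \<Rightarrow> 'a) set \<Rightarrow> bool" where
  "subshift X \<longleftrightarrow> closedin seq_topology X \<and> shift ` X = X"

definition admissible :: "(int \<Rightarrow> 'a) set \<Rightarrow> 'a list \<Rightarrow> bool" where
  "admissible X w \<longleftrightarrow> (\<exists>x\<in>X. \<exists>i. \<forall>k<length w. x (i + int k) = w ! k)"

text \<open>\<open>left_blocks X n\<close> is \<open>X\<^bsub>(-\<infinity>,n]\<^esub>\<close>, and \<open>extend x b\<close> is the left-infinite sequence \<open>(x\<^sup>-, b)\<close>.\<close>

definition left_blocks :: "(int \<Rightarrow> 'a) set \<Rightarrow> nat \<Rightarrow> (nat \<Rightarrow> 'a) set" where
  "left_blocks X n = (\<lambda>x i. x (int n - int i)) ` X"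

definition extend :: "(nat \<Rightarrow> 'a) \<Rightarrow> 'a list \<Rightarrow> (nat \<Rightarrow> 'a)" where
  "extend x b = (\<lambda>i. if i < length b then rev b ! i else x (i - length b))"

text \<open>The word \<open>x\<^sup>-\<^bsub>(-I,0]\<^esub>\<close>.\<close>

definition last_word :: "(nat \<Rightarrow> 'a) \<Rightarrow> nat \<Rightarrow> 'a list" where
  "last_word x I = rev (map x [0..<I])"

definition followers :: "(int \<Rightarrow> 'a) set \<Rightarrow> nat \<Rightarrow> (nat \<Rightarrow> 'a) \<Rightarrow> 'a list set"  (* \<Gamma>\<^sub>n\<^sup>+(x\<^sup>-) *)
  where "followers X n x = {b. length b = n \<and> extend x b \<in> left_blocks X n}"

definition predecessors :: "(int \<Rightarrow> 'a) set \<Rightarrow> 'a list \<Rightarrow> 'a list set"  (* \<Gamma>\<^sup>-(a) *)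
  where "predecessors X a = {c. admissible X (c @ a)}"

definition inf_predecessors :: "(int \<Rightarrow> 'a) set \<Rightarrow> 'a list \<Rightarrow> (nat \<Rightarrow> 'a) set"  (* \<Gamma>\<^sub>\<infinity>\<^sup>-(a) *)
  where "inf_predecessors X a = {x. extend x a \<in> left_blocks X 0}"

definition omega_plus :: "(int \<Rightarrow> 'a) set \<Rightarrow> nat \<Rightarrow> 'a list \<Rightarrow> 'a list set"  (* \<omega>\<^sub>n\<^sup>+(a) *)
  where "omega_plus X n a =
    {b. length b = n \<and> (\<forall>x\<in>inf_predecessors X a. extend x (a @ b) \<in> left_blocks X 0)}"

definition property_D :: "(int \<Rightarrow> 'a) set \<Rightarrow> bool" where
  "property_D X \<longleftrightarrow>
    (\<forall>b \<sigma>. admissible X (b @ [\<sigma>]) \<longrightarrow> (\<exists>a\<in>predecessors X b. [\<sigma>] \<in> omega_plus X 1 (a @ b)))"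


subsection \<open>Residually defined g-functions\<close>

definition residual_in :: "'b topology \<Rightarrow> 'b set \<Rightarrow> bool" where
  "residual_in T D \<longleftrightarrow>
    D \<subseteq> topspace T \<and> (\<exists>G. gdelta_in T G \<and> T closure_of G = topspace T \<and> G \<subseteq> D)"

text \<open>
  A function \<open>g : D\<^sup>-(g) \<times> \<Sigma> \<rightarrow> \<real>\<close> is a partial map with \<open>dom g = D\<^sup>-(g)\<close>, so that equality of such
  maps includes equality of the domains.
\<close>

type_synonym 'a gfun = "(nat \<Rightarrow> 'a) \<rightharpoonup> ('a \<Rightarrow> real)"

abbreviation gval :: "'a gfun \<Rightarrow> (nat \<Rightarrow> 'a) \<Rightarrow> 'a \<Rightarrow> real" where
  "gval g x \<equiv> the (g x)"

definition residual_g_function :: "(int \<Rightarrow> 'a::finite) set \<Rightarrow> 'a gfun \<Rightarrow> bool" where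
  "residual_g_function X g \<longleftrightarrow>
    residual_in (subtopology seq_topology (left_blocks X 0)) (dom g) \<and>
    continuous_map (prod_topology (subtopology seq_topology (dom g)) (discrete_topology UNIV))
      (top_of_set {0..1}) (\<lambda>(x, \<sigma>). gval g x \<sigma>) \<and>
    (\<forall>x\<in>dom g. (\<Sum>\<sigma> | [\<sigma>] \<in> followers X 1 x. gval g x \<sigma>) = 1 \<and>
       (\<forall>\<sigma>. [\<sigma>] \<notin> followers X 1 x \<longrightarrow> gval g x \<sigma> = 0)) \<and>
    (\<forall>y \<in> left_blocks X 0 - dom g.
       \<not> (\<exists>v. continuous_map (subtopology seq_topology (insert y (dom g)))
             (product_topology (\<lambda>_. euclideanreal) UNIV) ((gval g)(y := v)))) \<and>
    left_blocks X 1 =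
      seq_topology closure_of
        {extend x [\<alpha>] | x \<alpha>. x \<in> dom g \<and> [\<alpha>] \<in> followers X 1 x \<and> gval g x \<alpha> > 0}"


subsection \<open>The Shannon graph\<close>

definition seq_borel :: "(nat \<Rightarrow> 'a) measure" where
  "seq_borel = sigma UNIV {U. openin seq_topology U}"

definition prob_measures :: "(nat \<Rightarrow> 'a) measure set" where
  "prob_measures = {\<mu>. sets \<mu> = sets seq_borel \<and> prob_space \<mu>}"

text \<open>
  The coarsest topology for which integration against each continuous function is continuous; the
  underlying set is \<open>prob_measures\<close>.
\<close>

definition weak_star :: "(nat \<Rightarrow> 'a) measure topology" where
  "weak_star = topology_generated_by
    {{\<mu>\<in>prob_measures. integral\<^sup>L \<mu> f \<in> U} | f U.
       continuous_map seq_topology euclideanreal f \<and> open (U :: real set)}"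

definition cylinder :: "'a list \<Rightarrow> (nat \<Rightarrow> 'a) set" where
  "cylinder a = {x. \<forall>i<length a. x i = a ! i}"

definition trans_meas :: "'a list \<Rightarrow> (nat \<Rightarrow> 'a) measure \<Rightarrow> (nat \<Rightarrow> 'a) measure" where
  "trans_meas a \<mu> = (THE \<nu>. \<nu> \<in> prob_measures \<and>
     (\<forall>b. measure \<nu> (cylinder b) = measure \<mu> (cylinder (a @ b)) / measure \<mu> (cylinder a)))"

definition trans_set :: "'a list \<Rightarrow> (nat \<Rightarrow> 'a) measure set \<Rightarrow> (nat \<Rightarrow> 'a) measure set" where
  "trans_set a M = {trans_meas a \<mu> | \<mu>. \<mu> \<in> M \<and> measure \<mu> (cylinder a) > 0}"

definition transition_complete :: "(nat \<Rightarrow> 'a) measure set \<Rightarrow> bool" where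
  "transition_complete M \<longleftrightarrow> (\<forall>\<sigma>. trans_set [\<sigma>] M \<subseteq> M)"

definition condition_I :: "(nat \<Rightarrow> 'a) measure set \<Rightarrow> bool" where
  "condition_I M \<longleftrightarrow> M = weak_star closure_of (\<Union>\<alpha>. trans_set [\<alpha>] M)"

definition presented_subshift :: "(nat \<Rightarrow> 'a) measure set \<Rightarrow> (int \<Rightarrow> 'a) set" where
  "presented_subshift M =
    (THE X. subshift X \<and> (\<forall>a. admissible X a \<longleftrightarrow> (\<exists>\<mu>\<in>M. measure \<mu> (cylinder a) > 0)))"

definition past_set :: "(nat \<Rightarrow> 'a) measure set \<Rightarrow> (nat \<Rightarrow> 'a) \<Rightarrow> (nat \<Rightarrow> 'a) measure set"  (* M(x\<^sup>-) *)
  where "past_set M x = (\<Inter>I. weak_star closure_of (trans_set (last_word x I) M))"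

definition marginal :: "nat \<Rightarrow> (nat \<Rightarrow> 'a) measure \<Rightarrow> (nat \<Rightarrow> 'a) measure" where
  "marginal n \<mu> = distr \<mu> (PiM {..<n} (\<lambda>_. count_space UNIV)) (\<lambda>y. restrict y {..<n})"

definition D_meas :: "(nat \<Rightarrow> 'a) measure set \<Rightarrow> nat \<Rightarrow> (nat \<Rightarrow> 'a) set"  (* D\<^sub>n\<^sup>-(M) *)
  where "D_meas M n = {x \<in> left_blocks (presented_subshift M) 0.
    \<forall>\<mu>\<in>past_set M x. \<forall>\<nu>\<in>past_set M x. marginal n \<mu> = marginal n \<nu>}"

definition D_meas_inf :: "(nat \<Rightarrow> 'a) measure set \<Rightarrow> (nat \<Rightarrow> 'a) set" where
  "D_meas_inf M = (\<Inter>n. D_meas M n)"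

definition past_meas :: "(nat \<Rightarrow> 'a) measure set \<Rightarrow> (nat \<Rightarrow> 'a) \<Rightarrow> (nat \<Rightarrow> 'a) measure" where
  "past_meas M x = (THE \<mu>. \<mu> \<in> past_set M x)"

definition residually_contractive :: "(nat \<Rightarrow> 'a) measure set \<Rightarrow> bool" where
  "residually_contractive M \<longleftrightarrow>
    M \<subseteq> prob_measures \<and> transition_complete M \<and> condition_I M \<and>
    seq_topology closure_of (D_meas_inf M) = left_blocks (presented_subshift M) 0 \<and>
    (\<forall>x \<in> left_blocks (presented_subshift M) 0. \<forall>\<mu> \<in> past_set M x.
       \<exists>xs. (\<forall>k::nat. xs k \<in> D_meas_inf M) \<and>
         limitin seq_topology xs x sequentially \<and>
         limitin weak_star (\<lambda>k. past_meas M (xs k)) \<mu> sequentially)"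


subsection \<open>Passing between vertex sets and g-functions\<close>

text \<open>
  On \<open>D_meas M 1\<close> the value does not depend on the chosen element of \<open>past_set M x\<close>, which is nonempty
  when \<open>M\<close> is residually contractive.
\<close>

definition g_of :: "(nat \<Rightarrow> 'a) measure set \<Rightarrow> 'a gfun" where
  "g_of M = (\<lambda>x. if x \<in> D_meas M 1
     then Some (\<lambda>\<alpha>. measure (SOME \<mu>. \<mu> \<in> past_set M x) (cylinder [\<alpha>])) else None)"

definition D_g_inf :: "(int \<Rightarrow> 'a) set \<Rightarrow> 'a gfun \<Rightarrow> (nat \<Rightarrow> 'a) set" where
  "D_g_inf X g = {x \<in> dom g. \<forall>k. \<forall>a\<in>followers X k x. extend x a \<in> dom g}"

definition mu_inf :: "(int \<Rightarrow> 'a) set \<Rightarrow> 'a gfun \<Rightarrow> (nat \<Rightarrow> 'a) \<Rightarrow> (nat \<Rightarrow> 'a) measure" where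
  "mu_inf X g x = (THE \<mu>. \<mu> \<in> prob_measures \<and>
     (\<forall>a. measure \<mu> (cylinder a) =
        (if a \<in> followers X (length a) x
         then \<Prod>k<length a. gval g (extend x (take k a)) (a ! k) else 0)))"

definition vertex_set_of :: "(int \<Rightarrow> 'a) set \<Rightarrow> 'a gfun \<Rightarrow> (nat \<Rightarrow> 'a) measure set" where
  "vertex_set_of X g = weak_star closure_of (mu_inf X g ` D_g_inf X g)"

end

theory Submission
  imports Defs
begin

text \<open>
  A measure on \<open>\<Sigma>\<^sup>\<nat>\<close> is determined by its values on cylinders, and weak* convergence is convergence on
  cylinders; as every consistent family of cylinder values comes from a measure, the space of
  probability measures is compact. Hence the sets \<open>\<tau>(x\<^bsub>(-I,0]\<^esub>)M\<close> shrink to \<open>M(x)\<close> uniformly: every weak*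
  neighbourhood of \<open>M(x)\<close> contains one of their closures.

  (a) Elements of \<open>M(g)\<close> conditioned on a final word \<open>w\<close> of the past are limits of measures
  \<open>\<mu>\<^sub>\<infinity>(g)(z)\<close> with \<open>z\<close> ending in \<open>w\<close>, so continuity of \<open>g\<close> at \<open>x \<in> D\<^sup>-(g)\<close> forces the letter marginals of all
  elements of \<open>M(x)\<close> to be \<open>g(x, _)\<close>. Conversely, if the letter marginals on \<open>M(x)\<close> agree, uniform
  shrinking makes their common value a continuous extension of \<open>g\<close> to \<open>x\<close>, so \<open>x \<in> D\<^sup>-(g)\<close> by (ii).

  (b) For a past \<open>x\<close> all of whose continuations lie in \<open>D\<^sub>1\<^sup>-(M)\<close>, every element of \<open>M(x)\<close> has the
  cylinder values prescribed by \<open>g\<^bsub>M\<^esub>\<close>, so \<open>M(x)\<close> is a singleton. Such pasts are dense by a Baire argument,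
  and with (I), (III) and uniform shrinking their measures are dense in \<open>M\<close>.
\<close>

subsection \<open>The topology of sequence spaces\<close>

text \<open>Three obstacles shape the proof. First, \<open>presented_subshift\<close>,
  \<open>trans_meas\<close> and \<open>mu_inf\<close> are definite descriptions, so existence and
  uniqueness come before any use of them: a language closed under factors and prolongable on both
  sides belongs to exactly one subshift, and consistent cylinder values belong to exactly one
  measure. Second, a continuation \<open>a\<close> of \<open>x\<close> may be admissible and yet
  have measure zero for every element of M(x); conditioning then gives no hold on M((x,a)). So the
  knowledge that M(x) is a singleton does not control all continuations, while (III) speaks of
  singleton pasts and M(g_M) is built from pasts with all continuations in the domain. Uniform
  shrinking bridges the two: a past of the second kind that shares a long final word with
  \<open>x\<close> has its measure near that of \<open>x\<close>. Third, a condition on all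
  continuations of a past is an infinite family of requirements; these are stated for words, so that
  Baire's argument becomes a recursion that prolongs a word to the left.\<close>

lemma openin_seq:
  "openin seq_topology U \<longleftrightarrow>
     (\<forall>x\<in>U. \<exists>F. finite F \<and> (\<forall>y. (\<forall>i\<in>F. y i = x i) \<longrightarrow> y \<in> U))" (is "?L \<longleftrightarrow> ?R")
proof
  assume L: ?L
  show ?R
  proof
    fix x assume "x \<in> U"
    then obtain V where V: "finite {i. V i \<noteq> UNIV}" "x \<in> Pi\<^sub>E UNIV V" "Pi\<^sub>E UNIV V \<subseteq> U"
      using L unfolding seq_topology_def openin_product_topology_alt by force
    have "y \<in> U" if "\<forall>i\<in>{i. V i \<noteq> UNIV}. y i = x i" for y
    proof -
      have "y i \<in> V i" for i
        using that V(2) by (cases "V i = UNIV") (auto simp: PiE_iff)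
      then show ?thesis using V(3) by (auto simp: PiE_iff)
    qed
    then show "\<exists>F. finite F \<and> (\<forall>y. (\<forall>i\<in>F. y i = x i) \<longrightarrow> y \<in> U)" using V(1) by blast
  qed
next
  assume R: ?R
  show ?L unfolding seq_topology_def openin_product_topology_alt
  proof
    fix x assume "x \<in> U"
    then obtain F where F: "finite F" "\<And>y. (\<forall>i\<in>F. y i = x i) \<Longrightarrow> y \<in> U" using R by blast
    show "\<exists>V. finite {i \<in> UNIV. V i \<noteq> topspace (discrete_topology UNIV)} \<and>
       (\<forall>i\<in>UNIV. openin (discrete_topology UNIV) (V i)) \<and> x \<in> Pi\<^sub>E UNIV V \<and> Pi\<^sub>E UNIV V \<subseteq> U"
      by (rule exI[of _ "\<lambda>i. if i \<in> F then {x i} else UNIV"])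
        (use F in \<open>auto simp: PiE_iff intro: finite_subset split: if_splits\<close>)
  qed
qed

lemma topspace_seq [simp]: "topspace seq_topology = UNIV"
  by (simp add: seq_topology_def)

lemma compact_space_seq: "compact_space (seq_topology :: ('i \<Rightarrow> 'a::finite) topology)"
  unfolding seq_topology_def
  by (auto simp: compact_space_product_topology compact_space_discrete_topology)

lemma openin_seq_nat:
  fixes U :: "(nat \<Rightarrow> 'a) set"
  shows "openin seq_topology U \<longleftrightarrow> (\<forall>x\<in>U. \<exists>n. \<forall>y. (\<forall>i<n. y i = x i) \<longrightarrow> y \<in> U)"
proof -
  have "(\<exists>F. finite F \<and> (\<forall>y. (\<forall>i\<in>F. y i = x i) \<longrightarrow> y \<in> U)) \<longleftrightarrow>
        (\<exists>n. \<forall>y. (\<forall>i<n. y i = x i) \<longrightarrow> y \<in> U)" for x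
  proof
    assume "\<exists>F. finite F \<and> (\<forall>y. (\<forall>i\<in>F. y i = x i) \<longrightarrow> y \<in> U)"
    then obtain F where F: "finite F" "\<And>y. (\<forall>i\<in>F. y i = x i) \<Longrightarrow> y \<in> U" by blast
    obtain n where "\<forall>i\<in>F. i < n" using F(1) finite_nat_set_iff_bounded by blast
    then show "\<exists>n. \<forall>y. (\<forall>i<n. y i = x i) \<longrightarrow> y \<in> U" using F(2) by blast
  next
    assume "\<exists>n. \<forall>y. (\<forall>i<n. y i = x i) \<longrightarrow> y \<in> U"
    then obtain n where "\<And>y. (\<forall>i<n. y i = x i) \<Longrightarrow> y \<in> U" by blast
    then show "\<exists>F. finite F \<and> (\<forall>y. (\<forall>i\<in>F. y i = x i) \<longrightarrow> y \<in> U)"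
      by (intro exI[of _ "{..<n}"]) auto
  qed
  then show ?thesis unfolding openin_seq by simp
qed

text \<open>The hypothesis is symmetric in \<open>A\<close> and its complement, so one argument
  shows both to be open.\<close>

lemma clopen_seq:
  fixes A :: "('b \<Rightarrow> 'c) set"
  assumes "finite F" "\<And>x y. (\<And>i. i \<in> F \<Longrightarrow> x i = y i) \<Longrightarrow> x \<in> A \<longleftrightarrow> y \<in> A"
  shows "openin seq_topology A" "closedin seq_topology A"
proof -
  have *: "openin seq_topology B"
    if "\<And>x y. (\<And>i. i \<in> F \<Longrightarrow> x i = y i) \<Longrightarrow> x \<in> B \<longleftrightarrow> y \<in> B" for B :: "('b \<Rightarrow> 'c) set"
    unfolding openin_seq
  proof
    fix x assume "x \<in> B"
    then have "\<forall>y. (\<forall>i\<in>F. y i = x i) \<longrightarrow> y \<in> B" using that by metis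
    then show "\<exists>F. finite F \<and> (\<forall>y. (\<forall>i\<in>F. y i = x i) \<longrightarrow> y \<in> B)" using assms(1) by blast
  qed
  show "openin seq_topology A" using assms(2) by (rule *)
  have "openin seq_topology (- A)" by (rule *) (use assms(2) in blast)
  then show "closedin seq_topology A" by (simp add: closedin_def Compl_eq_Diff_UNIV)
qed

lemma in_closure_seq:
  fixes S :: "(nat \<Rightarrow> 'a) set"
  shows "x \<in> seq_topology closure_of S \<longleftrightarrow> (\<forall>n. \<exists>y\<in>S. \<forall>i<n. y i = x i)"
proof -
  have *: "openin seq_topology {y. \<forall>i<n. y i = x i}" for n
    by (rule clopen_seq(1)[of "{..<n}"]) auto
  show ?thesis
    unfolding in_closure_of
  proof safe
    fix n assume "\<forall>T. x \<in> T \<and> openin seq_topology T \<longrightarrow> (\<exists>y. y \<in> S \<and> y \<in> T)"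
    from this[rule_format, of "{y. \<forall>i<n. y i = x i}"] * show "\<exists>y\<in>S. \<forall>i<n. y i = x i" by auto
  next
    fix T assume "\<forall>n. \<exists>y\<in>S. \<forall>i<n. y i = x i" "x \<in> T" "openin seq_topology T"
    then show "\<exists>y. y \<in> S \<and> y \<in> T" unfolding openin_seq_nat by metis
  qed simp
qed

text \<open>Uniform continuity by compactness: failure at every length \<open>n\<close> yields a
  point around which the oscillation of \<open>f\<close> never drops below \<open>e\<close>.\<close>

lemma continuous_seq_uniform:
  fixes f :: "(nat \<Rightarrow> 'a::finite) \<Rightarrow> real"
  assumes f: "continuous_map seq_topology euclideanreal f" and "e > 0"
  shows "\<exists>n. \<forall>x y. (\<forall>i<n. x i = y i) \<longrightarrow> \<bar>f x - f y\<bar> < e"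
proof (rule ccontr)
  \<comment> \<open>The points whose cylinder of length \<open>n\<close> contains a bad pair. As
    this depends on the first \<open>n\<close> coordinates only, \<open>C n\<close> is closed
    without regard to \<open>f\<close>.\<close>
  define C where "C n = {x. \<exists>y z. (\<forall>i<n. y i = x i) \<and> (\<forall>i<n. z i = x i) \<and> \<not> \<bar>f y - f z\<bar> < e}" for n
  assume "\<not> ?thesis"
  then have "C n \<noteq> {}" for n unfolding C_def by blast
  moreover have "closedin seq_topology (C n)" for n
    by (rule clopen_seq(2)[of "{..<n}"]) (auto simp: C_def)
  moreover have "decseq C" unfolding decseq_def C_def by (blast dest: less_le_trans)
  ultimately obtain x where x: "\<And>n. x \<in> C n"
    using compact_space_imp_nest[OF compact_space_seq, of C] by blast
  define B where "B = {y \<in> topspace seq_topology. f y \<in> ball (f x) (e/2)}"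
  have B: "openin seq_topology B"
    unfolding B_def by (rule openin_continuous_map_preimage[OF f]) simp
  have "x \<in> B" using \<open>e > 0\<close> by (simp add: B_def)
  with B obtain n where n: "\<And>y. (\<forall>i<n. y i = x i) \<Longrightarrow> y \<in> B"
    unfolding openin_seq_nat by blast
  have "x \<in> C n" by (rule x)
  then obtain y z where yz: "\<forall>i<n. y i = x i" "\<forall>i<n. z i = x i" "\<not> \<bar>f y - f z\<bar> < e"
    unfolding C_def mem_Collect_eq by (elim exE conjE)
  have "y \<in> B" "z \<in> B" using n yz(1,2) by blast+
  with yz(3) show False unfolding B_def by (simp add: dist_real_def) (smt (verit) field_sum_of_halves)
qed

section \<open>Cylinders and Borel sets\<close>

lemma cylinder_Nil [simp]: "cylinder [] = UNIV"
  by (simp add: cylinder_def)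

lemma cylinder_snoc: "cylinder (a @ [s]) = cylinder a \<inter> {x. x (length a) = s}"
  by (auto simp: cylinder_def nth_append less_Suc_eq)

lemma cylinder_append_subset: "cylinder (a @ b) \<subseteq> cylinder a"
  by (auto simp: cylinder_def nth_append)

lemma openin_cylinder: "openin seq_topology (cylinder a)"
  by (rule clopen_seq(1)[of "{..<length a}"]) (auto simp: cylinder_def)

lemma finite_words: "finite {a :: 'a::finite list. length a = n}"
  using finite_lists_length_eq[of "UNIV :: 'a set" n] by simp

text \<open>Two cylinders are nested or disjoint, according to whether the shorter word is a prefix
  of the longer. The empty set is added for the disjoint case.\<close>

lemma Int_stable_cylinders: "Int_stable (insert {} (range cylinder))"
proof (rule Int_stableI, safe)
  fix a b :: "'a list"
  assume ne: "cylinder a \<inter> cylinder b \<notin> range cylinder"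
  have *: "cylinder a \<inter> cylinder b = {} \<or> cylinder a \<inter> cylinder b \<in> range cylinder"
    if le: "length a \<le> length b" for a b :: "'a list"
  proof (cases "take (length a) b = a")
    case True
    then have "b = a @ drop (length a) b" by (metis append_take_drop_id)
    then have "cylinder b \<subseteq> cylinder a" by (metis cylinder_append_subset)
    then show ?thesis by (metis inf.absorb2 rangeI)
  next
    case False
    then have "cylinder a \<inter> cylinder b = {}"
      using le by (auto simp: cylinder_def list_eq_iff_nth_eq)
    then show ?thesis by blast
  qed
  fix x assume "x \<in> cylinder a" "x \<in> cylinder b"
  with ne *[of a b] *[of b a] show "x \<in> {}" by (cases "length a \<le> length b") (auto simp: Int_commute)
qed

text \<open>An open set is the union of the cylinders inside it, and there are only countably many
  words.\<close>

lemma sets_seq_borel: "sets (seq_borel :: (nat \<Rightarrow> 'a::finite) measure) = sigma_sets UNIV (insert {} (range cylinder))"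
proof -
  have "sigma_sets UNIV {U. openin seq_topology U} = sigma_sets UNIV (insert {} (range (cylinder :: 'a list \<Rightarrow> _)))"
  proof (rule sigma_sets_eqI)
    fix U :: "(nat \<Rightarrow> 'a) set" assume "U \<in> {U. openin seq_topology U}"
    then have U: "\<forall>x\<in>U. \<exists>n. \<forall>y. (\<forall>i<n. y i = x i) \<longrightarrow> y \<in> U" by (simp add: openin_seq_nat)
    have "U = (\<Union>a\<in>{a. cylinder a \<subseteq> U}. cylinder a)"
    proof (intro equalityI subsetI)
      fix x assume "x \<in> U"
      then obtain n where n: "\<And>y. (\<forall>i<n. y i = x i) \<Longrightarrow> y \<in> U" using U by blast
      have "cylinder (map x [0..<n]) \<subseteq> U" "x \<in> cylinder (map x [0..<n])"
        using n by (auto simp: cylinder_def)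
      then show "x \<in> (\<Union>a\<in>{a. cylinder a \<subseteq> U}. cylinder a)" by blast
    qed blast
    moreover have "(\<Union>a\<in>{a. cylinder a \<subseteq> U}. cylinder a) \<in> sigma_sets UNIV (insert {} (range cylinder))"
      by (rule sigma_sets_UNION) auto
    ultimately show "U \<in> sigma_sets UNIV (insert {} (range cylinder))" by simp
  qed (auto intro: openin_cylinder)
  then show ?thesis unfolding seq_borel_def by simp
qed

lemma space_seq_borel [simp]: "space seq_borel = UNIV"
  by (simp add: seq_borel_def)

lemma cylinder_sets [simp]: "cylinder (a :: 'a::finite list) \<in> sets seq_borel"
  unfolding sets_seq_borel by (rule sigma_sets.Basic) simp

lemma measurable_seq_borel_continuous:
  assumes "continuous_map seq_topology euclideanreal f"
  shows "f \<in> borel_measurable seq_borel"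
proof (rule borel_measurableI)
  fix S :: "real set" assume "open S"
  then have "openin seq_topology {x \<in> topspace seq_topology. f x \<in> S}"
    by (intro openin_continuous_map_preimage[OF assms]) simp
  then show "f -` S \<inter> space seq_borel \<in> sets seq_borel"
    by (simp add: seq_borel_def vimage_def sigma_sets.Basic)
qed

subsection \<open>Cylinder values and the weak* topology\<close>

text \<open>A measure becomes a point of the product space of real functions on words; the weak*
  topology turns out to be that of pointwise convergence there.\<close>

definition cyl :: "(nat \<Rightarrow> 'a) measure \<Rightarrow> 'a list \<Rightarrow> real" where
  "cyl \<mu> = (\<lambda>a. measure \<mu> (cylinder a))"

lemma cylinder_iff_map: "y \<in> cylinder a \<longleftrightarrow> map y [0..<length a] = a"
proof
  assume "y \<in> cylinder a"
  then show "map y [0..<length a] = a"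
    by (intro nth_equalityI) (simp_all add: cylinder_def)
next
  assume eq: "map y [0..<length a] = a"
  have "y i = a ! i" if "i < length a" for i
  proof -
    have "y i = map y [0..<length a] ! i" using that by simp
    then show ?thesis by (simp only: eq)
  qed
  then show "y \<in> cylinder a" by (simp add: cylinder_def)
qed

text \<open>Kolmogorov's consistency conditions. By \<open>consistent_cyl\<close> and
  \<open>ex_measure_cyl\<close> they describe exactly the functions \<open>cyl \<mu>\<close> with
  \<open>\<mu> \<in> prob_measures\<close>.\<close>

definition consistent :: "('a::finite list \<Rightarrow> real) \<Rightarrow> bool" where
  "consistent p \<longleftrightarrow> p [] = 1 \<and> (\<forall>a. 0 \<le> p a) \<and> (\<forall>a. (\<Sum>s\<in>UNIV. p (a @ [s])) = p a)"

lemma consistent_snoc_le: "consistent p \<Longrightarrow> p (a @ [s]) \<le> p a"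
  using member_le_sum[of s UNIV "\<lambda>s. p (a @ [s])"] by (simp add: consistent_def)

lemma consistent_append_le: "consistent p \<Longrightarrow> p (a @ b) \<le> p a"
proof (induction b rule: rev_induct)
  case (snoc s b)
  then show ?case using consistent_snoc_le[of p "a @ b" s] by simp
qed simp

lemma consistent_le_1: "consistent p \<Longrightarrow> p a \<le> 1"
  using consistent_append_le[of p "[]" a] by (simp add: consistent_def)

lemma consistent_nonneg: "consistent p \<Longrightarrow> 0 \<le> p a"
  by (simp add: consistent_def)

lemma consistent_cyl:
  fixes \<mu> :: "(nat \<Rightarrow> 'a::finite) measure"
  assumes "\<mu> \<in> prob_measures"
  shows "consistent (cyl \<mu>)"
proof -
  interpret prob_space \<mu> using assms by (simp add: prob_measures_def)
  have sets: "sets \<mu> = sets seq_borel" and space: "space \<mu> = UNIV"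
    using assms sets_eq_imp_space_eq[of \<mu> seq_borel] by (auto simp: prob_measures_def)
  have "(\<Sum>s\<in>UNIV. prob (cylinder (a @ [s]))) = prob (cylinder a)" for a
  proof -
    have "prob (\<Union>s\<in>UNIV. cylinder (a @ [s])) = (\<Sum>s\<in>UNIV. prob (cylinder (a @ [s])))"
    proof (rule finite_measure_finite_Union)
      show "disjoint_family_on (\<lambda>s. cylinder (a @ [s])) UNIV"
        by (auto simp: disjoint_family_on_def cylinder_snoc)
    qed (auto simp: sets)
    moreover have "(\<Union>s\<in>UNIV. cylinder (a @ [s])) = cylinder a"
      by (auto simp: cylinder_snoc)
    ultimately show ?thesis by simp
  qed
  moreover have "prob UNIV = 1" using prob_space by (simp add: space)
  ultimately show ?thesis by (simp add: consistent_def cyl_def)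
qed

lemma cyl_inj:
  fixes \<mu> \<nu> :: "(nat \<Rightarrow> 'a::finite) measure"
  assumes "\<mu> \<in> prob_measures" "\<nu> \<in> prob_measures" "cyl \<mu> = cyl \<nu>"
  shows "\<mu> = \<nu>"
proof -
  interpret M: prob_space \<mu> using assms by (simp add: prob_measures_def)
  interpret N: prob_space \<nu> using assms by (simp add: prob_measures_def)
  show ?thesis
  proof (rule measure_eqI_generator_eq[OF Int_stable_cylinders, of UNIV _ _ "\<lambda>_. UNIV"])
    fix A assume "A \<in> insert {} (range (cylinder :: 'a list \<Rightarrow> _))"
    then show "emeasure \<mu> A = emeasure \<nu> A"
      using fun_cong[OF assms(3)]
      by (auto simp: M.emeasure_eq_measure N.emeasure_eq_measure cyl_def)
  next
    show "range (\<lambda>_. UNIV) \<subseteq> insert {} (range (cylinder :: 'a list \<Rightarrow> _))"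
      by (metis cylinder_Nil insertI2 rangeI image_subsetI)
  qed (use assms in \<open>auto simp: prob_measures_def sets_seq_borel\<close>)
qed

lemma ex_pmf:
  fixes r :: "'a::finite \<Rightarrow> real"
  assumes "\<And>s. 0 \<le> r s" "sum r UNIV = 1"
  shows "\<exists>K. \<forall>s. pmf K s = r s"
proof -
  have "(\<integral>\<^sup>+x. ennreal (r x) \<partial>count_space UNIV) = 1"
    using assms by (simp add: nn_integral_count_space_finite sum_ennreal)
  then show ?thesis using pmf_embed_pmf[of r] assms(1) by blast
qed

text \<open>
  Choose for every word, independently, a next letter with the conditional law prescribed by \<open>p\<close>,
  and follow these choices starting from the empty word: cylinders then pull back to product sets.
\<close>

lemma ex_measure_cyl:
  fixes p :: "'a::finite list \<Rightarrow> real"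
  assumes "consistent p"
  shows "\<exists>\<mu>\<in>prob_measures. cyl \<mu> = p"
proof -
  \<comment> \<open>For \<open>p a = 0\<close> the conditional law is undetermined. A point mass
    keeps \<open>r a\<close> a probability vector, and \<open>p a * r a s = p (a @ [s])\<close>
    still holds because both sides are zero.\<close>
  define r where "r a s = (if p a = 0 then if s = undefined then 1 else 0 else p (a @ [s]) / p a)"
    for a s
  have "\<exists>K. \<forall>s. pmf K s = r a s" for a
  proof (rule ex_pmf)
    show "0 \<le> r a s" for s using assms by (simp add: r_def consistent_def)
    show "sum (r a) UNIV = 1"
      using assms by (cases "p a = 0") (simp_all add: r_def consistent_def flip: sum_divide_distrib)
  qed
  then obtain K where K: "\<And>a s. pmf (K a) s = r a s" by metis
  interpret product_prob_space "\<lambda>a. measure_pmf (K a)" UNIV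
    by (rule product_prob_spaceI) (rule prob_space_measure_pmf)
  let ?P = "PiM UNIV (\<lambda>a. measure_pmf (K a))"
  define w where "w \<xi> n = ((\<lambda>a. a @ [\<xi> a]) ^^ n) []" for \<xi> :: "'a list \<Rightarrow> 'a" and n
  define y where "y \<xi> n = \<xi> (w \<xi> n)" for \<xi> n
  have w_Suc: "w \<xi> (Suc n) = w \<xi> n @ [\<xi> (w \<xi> n)]" and w_0: "w \<xi> 0 = []" for \<xi> n
    by (simp_all add: w_def)
  have y_w: "map (y \<xi>) [0..<n] = w \<xi> n" for \<xi> n
    by (induction n) (simp_all add: w_0 w_Suc y_def)
  have w_iff: "w \<xi> (length a) = a \<longleftrightarrow> (\<forall>k<length a. \<xi> (take k a) = a ! k)" for \<xi> a
    by (induction a rule: rev_induct) (auto simp: w_0 w_Suc nth_append less_Suc_eq)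
  have cyl_w: "y \<xi> \<in> cylinder a \<longleftrightarrow> w \<xi> (length a) = a" for \<xi> a
    by (simp only: cylinder_iff_map y_w)
  \<comment> \<open>The proper prefixes of \<open>a\<close>. They are distinct, so the choices made
    at them are independent; \<open>a ! length b\<close> is the letter of \<open>a\<close> that
    follows the prefix \<open>b\<close>.\<close>
  define J where "J a = (\<lambda>k. take k a) ` {..<length a}" for a :: "'a list"
  have pre: "y -` cylinder a \<inter> space ?P = prod_emb UNIV (\<lambda>a. measure_pmf (K a)) (J a) (Pi\<^sub>E (J a) (\<lambda>b. {a ! length b}))" for a
  proof (rule set_eqI)
    fix \<xi>
    have "\<xi> \<in> prod_emb UNIV (\<lambda>a. measure_pmf (K a)) (J a) (Pi\<^sub>E (J a) (\<lambda>b. {a ! length b})) \<longleftrightarrow>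
        (\<forall>b\<in>J a. \<xi> b = a ! length b)"
      by (simp add: prod_emb_def Pi_iff)
    also have "\<dots> \<longleftrightarrow> (\<forall>k<length a. \<xi> (take k a) = a ! k)" by (auto simp: J_def)
    also have "\<dots> \<longleftrightarrow> \<xi> \<in> y -` cylinder a \<inter> space ?P" by (simp add: space_PiM cyl_w w_iff)
    finally show "\<xi> \<in> y -` cylinder a \<inter> space ?P \<longleftrightarrow>
      \<xi> \<in> prod_emb UNIV (\<lambda>a. measure_pmf (K a)) (J a) (Pi\<^sub>E (J a) (\<lambda>b. {a ! length b}))" ..
  qed
  have sets: "y -` cylinder a \<inter> space ?P \<in> sets ?P" for a
    unfolding pre by (rule sets_PiM_I) (auto simp: J_def)
  have meas: "y \<in> measurable ?P seq_borel"
    by (rule measurable_sigma_sets[OF sets_seq_borel]) (use sets in auto)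
  define \<mu> where "\<mu> = distr ?P seq_borel y"
  have \<mu>: "\<mu> \<in> prob_measures"
    unfolding \<mu>_def prob_measures_def using meas by (auto intro: prob_space_distr)
  have "cyl \<mu> a = p a" for a
  proof -
    have "cyl \<mu> a = measure ?P (y -` cylinder a \<inter> space ?P)"
      unfolding cyl_def \<mu>_def by (rule measure_distr[OF meas]) simp
    also have "\<dots> = (\<Prod>b\<in>J a. measure (measure_pmf (K b)) {a ! length b})"
      unfolding pre by (rule measure_PiM_emb) (auto simp: J_def)
    also have "\<dots> = (\<Prod>k<length a. r (take k a) (a ! k))"
    proof -
      have "inj_on (\<lambda>k. take k a) {..<length a}"
      proof (rule inj_onI)
        fix k l assume kl: "k \<in> {..<length a}" "l \<in> {..<length a}" "take k a = take l a"
        have "k = length (take k a)" using kl(1) by simp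
        also have "\<dots> = length (take l a)" by (simp only: kl(3))
        also have "\<dots> = l" using kl(2) by simp
        finally show "k = l" .
      qed
      then show ?thesis
        unfolding J_def by (simp add: prod.reindex measure_pmf_single K)
    qed
    also have "\<dots> = p a"
    proof (induction a rule: rev_induct)
      case Nil
      then show ?case using assms by (simp add: consistent_def)
    next
      case (snoc s a)
      have "(\<Prod>k<length (a @ [s]). r (take k (a @ [s])) ((a @ [s]) ! k)) = p a * r a s"
        by (simp add: nth_append flip: snoc)
      also have "\<dots> = p (a @ [s])"
        using consistent_snoc_le[OF assms, of a s] consistent_nonneg[OF assms, of "a @ [s]"]
        by (auto simp: r_def)
      finally show ?case .
    qed
    finally show ?thesis .
  qed
  with \<mu> show ?thesis by blast
qed

section \<open>Open sets, compactness and closures in the weak* topology\<close>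

text \<open>On each cylinder of length \<open>n\<close>, \<open>f\<close> is replaced by its value
  at the sample point \<open>h a\<close>; the integral of the resulting step function
  \<open>F\<close> is the sum.\<close>

lemma integral_approx_cyl:
  fixes \<mu> :: "(nat \<Rightarrow> 'a::finite) measure"
  assumes \<mu>: "\<mu> \<in> prob_measures" and f: "continuous_map seq_topology euclideanreal f"
    and n: "\<And>x y. (\<forall>i<n. x i = y i) \<Longrightarrow> \<bar>f x - f y\<bar> < e"
    and h: "\<And>a. length a = n \<Longrightarrow> h a \<in> cylinder a"
  shows "\<bar>integral\<^sup>L \<mu> f - (\<Sum>a | length a = n. cyl \<mu> a * f (h a))\<bar> \<le> e"
proof -
  interpret prob_space \<mu> using \<mu> by (simp add: prob_measures_def)
  have sets: "sets \<mu> = sets seq_borel" and space: "space \<mu> = UNIV"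
    using \<mu> sets_eq_imp_space_eq[of \<mu> seq_borel] by (auto simp: prob_measures_def)
  have int_ind: "integrable \<mu> (indicat_real (cylinder a))" for a :: "'a list"
    by (rule integrable_real_indicator) (simp_all add: sets emeasure_eq_measure)
  define F where "F x = (\<Sum>a | length a = n. f (h a) * indicator (cylinder a) x)" for x
  have F: "F x = f (h (map x [0..<n]))" for x
  proof -
    have "F x = (\<Sum>a | length a = n. if a = map x [0..<n] then f (h a) else 0)"
      unfolding F_def
      by (rule sum.cong) (auto simp: indicator_def cylinder_def list_eq_iff_nth_eq)
    then show ?thesis by (simp add: finite_words)
  qed
  have fF: "\<bar>f x - F x\<bar> \<le> e" for x
    using n[of x "h (map x [0..<n])"] h[of "map x [0..<n]"] unfolding F
    by (force simp: cylinder_def)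
  have intF: "integrable \<mu> F"
    unfolding F_def by (auto intro!: integrable_real_mult_indicator simp: sets)
  have meas: "f \<in> borel_measurable \<mu>"
    using measurable_seq_borel_continuous[OF f] measurable_cong_sets[OF sets refl] by blast
  \<comment> \<open>Integrability of \<open>f\<close> is obtained here: \<open>f - F\<close> is
    bounded and measurable, and \<open>F\<close> is a finite combination of indicators.\<close>
  have "integrable \<mu> (\<lambda>x. f x - F x)"
    by (rule integrable_const_bound[of _ e]) (use fF meas intF in auto)
  then have "integrable \<mu> (\<lambda>x. (f x - F x) + F x)"
    using intF by (rule Bochner_Integration.integrable_add)
  then have intf: "integrable \<mu> f" by simp
  have "integral\<^sup>L \<mu> F = (\<Sum>a | length a = n. cyl \<mu> a * f (h a))"
    unfolding F_def by (subst Bochner_Integration.integral_sum)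
      (auto simp: sets cyl_def space mult.commute int_ind)
  then have "\<bar>integral\<^sup>L \<mu> f - (\<Sum>a | length a = n. cyl \<mu> a * f (h a))\<bar> = \<bar>integral\<^sup>L \<mu> (\<lambda>x. f x - F x)\<bar>"
    using intf intF by simp
  also have "\<dots> \<le> integral\<^sup>L \<mu> (\<lambda>x. \<bar>f x - F x\<bar>)" by (rule integral_abs_bound)
  also have "\<dots> \<le> integral\<^sup>L \<mu> (\<lambda>x. e)"
    by (rule integral_mono) (use intf intF fF in auto)
  also have "\<dots> = e" by (simp add: prob_space)
  finally show ?thesis .
qed

lemma topspace_weak_star [simp]:
  "topspace weak_star = (prob_measures :: (nat \<Rightarrow> 'a::finite) measure set)"
proof -
  let ?B = "{{\<mu>\<in>prob_measures. integral\<^sup>L \<mu> f \<in> U} | f U.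
    continuous_map (seq_topology :: (nat \<Rightarrow> 'a) topology) euclideanreal f \<and> open (U :: real set)}"
  have "prob_measures = {\<mu>\<in>prob_measures. integral\<^sup>L \<mu> (\<lambda>_ :: nat \<Rightarrow> 'a. 0) \<in> (UNIV :: real set)}"
    by simp
  moreover have "\<dots> \<in> ?B"
    unfolding mem_Collect_eq by (intro exI[of _ "\<lambda>_. 0"] exI[of _ UNIV] conjI refl) simp_all
  ultimately have "prob_measures \<in> ?B" by (rule ssubst)
  then have "prob_measures \<subseteq> \<Union>?B" by (rule Union_upper)
  moreover have "\<Union>?B \<subseteq> prob_measures"
    by (rule Union_least, elim CollectE exE conjE) (simp add: Collect_restrict)
  ultimately show ?thesis unfolding weak_star_def topology_generated_by_topspace by (intro equalityI)
qed

text \<open>Indicators of cylinders are continuous, so cylinder values are among the integrals that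
  generate the topology. Conversely, a continuous function is uniformly close to functions of
  finitely many coordinates, so its integral is a uniform limit of continuous functions of the
  cylinder values.\<close>

lemma openin_weak_star:
  fixes U :: "(nat \<Rightarrow> 'a::finite) measure set"
  shows "openin weak_star U \<longleftrightarrow> (\<exists>V. open V \<and> U = {\<mu>\<in>prob_measures. cyl \<mu> \<in> V})"
    (is "?L \<longleftrightarrow> ?R")
proof
  let ?B = "{{\<mu>\<in>prob_measures. integral\<^sup>L \<mu> f \<in> U} | f U.
    continuous_map (seq_topology :: (nat \<Rightarrow> 'a) topology) euclideanreal f \<and> open (U :: real set)}"
  define T where "T = pullback_topology prob_measures (cyl :: (nat \<Rightarrow> 'a) measure \<Rightarrow> _) euclidean"
  have openin_T: "openin T U \<longleftrightarrow> (\<exists>V. open V \<and> U = {\<mu>\<in>prob_measures. cyl \<mu> \<in> V})" for U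
    unfolding T_def openin_pullback_topology by (auto simp: vimage_def Int_def conj_commute)
  {
    assume ?L
    then have "generate_topology_on ?B U"
      unfolding weak_star_def by (rule openin_topology_generated_by)
    then have "openin T U"
    proof (rule generate_topology_on_coarsest[rotated 2])
      fix S assume "S \<in> ?B"
      then obtain f U where f: "continuous_map (seq_topology :: (nat \<Rightarrow> 'a) topology) euclideanreal f"
        and U: "open U" and S: "S = {\<mu>\<in>prob_measures. integral\<^sup>L \<mu> f \<in> U}" by blast
      \<comment> \<open>Through the inverse of \<open>cyl\<close> the integral becomes a function on
        \<open>P\<close>, where it is the uniform limit of the finite sums
        \<open>G k\<close>.\<close>
      define P where "P = {p :: 'a list \<Rightarrow> real. consistent p}"
      define inv where "inv p = (SOME \<mu>. \<mu> \<in> prob_measures \<and> cyl \<mu> = p)" for p :: "'a list \<Rightarrow> real"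
      have inv: "inv p \<in> prob_measures" "cyl (inv p) = p" if "p \<in> P" for p
        using someI_ex[of "\<lambda>\<mu>. \<mu> \<in> prob_measures \<and> cyl \<mu> = p"] ex_measure_cyl[of p] that
        unfolding inv_def P_def by auto
      have inv_cyl: "inv (cyl \<mu>) = \<mu>" "cyl \<mu> \<in> P" if "\<mu> \<in> prob_measures" for \<mu>
        using inv[of "cyl \<mu>"] cyl_inj[of "inv (cyl \<mu>)" \<mu>] consistent_cyl[OF that] that
        by (auto simp: P_def)
      obtain N where N: "\<And>k x y. (\<forall>i<N k. x i = y i) \<Longrightarrow> \<bar>f x - f y\<bar> < 1 / real (Suc k)"
      proof -
        have "\<exists>n. \<forall>x y. (\<forall>i<n. x i = y i) \<longrightarrow> \<bar>f x - f y\<bar> < 1 / real (Suc k)" for k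
          by (rule continuous_seq_uniform[OF f]) simp
        then show ?thesis using that by metis
      qed
      define h where "h a = (\<lambda>i. if i < length a then a ! i else undefined)" for a :: "'a list"
      define G where "G k p = (\<Sum>a | length a = N k. p a * f (h a))" for k p
      have G: "\<bar>integral\<^sup>L (inv p) f - G k p\<bar> \<le> 1 / real (Suc k)" if "p \<in> P" for p k
        using integral_approx_cyl[OF inv(1)[OF that] f N[of k], where h = h] inv(2)[OF that]
        by (simp add: G_def h_def cylinder_def)
      have "continuous_on P (\<lambda>p. integral\<^sup>L (inv p) f)"
      proof (rule uniform_limit_theorem[where F = sequentially and f = G])
        show "\<forall>\<^sub>F k in sequentially. continuous_on P (G k)"
          unfolding G_def
          by (intro always_eventually allI continuous_intros continuous_on_subset[OF continuous_on_product_coordinates]) auto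
        show "uniform_limit P G (\<lambda>p. integral\<^sup>L (inv p) f) sequentially"
        proof (rule uniform_limitI)
          fix e :: real assume "e > 0"
          then obtain k where k: "1 / real (Suc k) < e" using nat_approx_posE by blast
          have "dist (G m p) (integral\<^sup>L (inv p) f) < e" if "m \<ge> k" "p \<in> P" for m p
          proof -
            have "1 / real (Suc m) \<le> 1 / real (Suc k)" using that by (simp add: frac_le)
            then show ?thesis using G[OF that(2), of m] k by (simp add: dist_real_def abs_minus_commute)
          qed
          then show "\<forall>\<^sub>F m in sequentially. \<forall>p\<in>P. dist (G m p) (integral\<^sup>L (inv p) f) < e"
            unfolding eventually_sequentially by blast
        qed
      qed simp
      then obtain V where V: "open V" "V \<inter> P = (\<lambda>p. integral\<^sup>L (inv p) f) -` U \<inter> P"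
        using U unfolding continuous_on_open_invariant by blast
      have "S = {\<mu>\<in>prob_measures. cyl \<mu> \<in> V}"
        unfolding S
      proof (intro Collect_cong conj_cong refl)
        fix \<mu> :: "(nat \<Rightarrow> 'a) measure" assume \<mu>: "\<mu> \<in> prob_measures"
        have "cyl \<mu> \<in> V \<inter> P \<longleftrightarrow> cyl \<mu> \<in> (\<lambda>p. integral\<^sup>L (inv p) f) -` U \<inter> P"
          by (simp only: V(2))
        then show "integral\<^sup>L \<mu> f \<in> U \<longleftrightarrow> cyl \<mu> \<in> V" by (simp add: inv_cyl[OF \<mu>])
      qed
      then show "openin T S" using V(1) openin_T by blast
    qed (rule istopology_openin)
    then show ?R by (simp add: openin_T)
  }
  assume ?R
  then obtain V where V: "open V" "U = {\<mu>\<in>prob_measures. cyl \<mu> \<in> V}" by blast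
  have "continuous_map weak_star euclideanreal (\<lambda>\<mu>. cyl \<mu> a)" for a :: "'a list"
    unfolding continuous_map_def topspace_weak_star
  proof (intro conjI allI impI)
    fix W :: "real set" assume "openin euclideanreal W"
    then have W: "open W" by simp
    have "continuous_map seq_topology euclideanreal (indicat_real (cylinder a))"
      unfolding continuous_map_def
    proof (intro conjI allI impI)
      fix A :: "real set"
      show "openin seq_topology {x \<in> topspace seq_topology. indicat_real (cylinder a) x \<in> A}"
        by (rule clopen_seq(1)[of "{..<length a}"]) (auto simp: cylinder_def indicator_def)
    qed simp
    then have "openin weak_star {\<mu>\<in>prob_measures. integral\<^sup>L \<mu> (indicat_real (cylinder a)) \<in> W}"
      unfolding weak_star_def using W by (intro topology_generated_by_Basis) blast
    moreover have "integral\<^sup>L \<mu> (indicat_real (cylinder a)) = cyl \<mu> a" if "\<mu> \<in> prob_measures" for \<mu>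
      using that sets_eq_imp_space_eq[of \<mu> seq_borel] by (simp add: cyl_def prob_measures_def)
    then have "{\<mu>\<in>prob_measures. integral\<^sup>L \<mu> (indicat_real (cylinder a)) \<in> W} =
        {\<mu>\<in>prob_measures. cyl \<mu> a \<in> W}"
      by (intro Collect_cong conj_cong refl) simp
    ultimately show "openin weak_star {\<mu>\<in>prob_measures. cyl \<mu> a \<in> W}" by simp
  qed simp
  then have "continuous_map weak_star euclidean (cyl :: (nat \<Rightarrow> 'a) measure \<Rightarrow> _)"
    unfolding euclidean_product_topology[symmetric] continuous_map_componentwise_UNIV by blast
  then have "openin weak_star {\<mu>\<in>topspace weak_star. cyl \<mu> \<in> V}"
    by (rule openin_continuous_map_preimage) (use V in simp)
  then show ?L unfolding V(2) topspace_weak_star .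
qed

text \<open>Tychonoff: a closed subset of a cube, the conditions being equations and inequalities
  between finitely many coordinates each.\<close>

lemma compact_consistent: "compact {p :: 'a::finite list \<Rightarrow> real. consistent p}"
proof -
  have [continuous_intros]: "continuous_on UNIV (\<lambda>p :: 'a list \<Rightarrow> real. p a)" for a
    by simp
  have "compactin euclidean (PiE UNIV (\<lambda>_::'a list. {0..1::real}))"
    unfolding euclidean_product_topology[symmetric] compactin_PiE by simp
  moreover have "closed {p :: 'a list \<Rightarrow> real. consistent p}"
    unfolding consistent_def
    by (intro closed_Collect_conj closed_Collect_all closed_Collect_le closed_Collect_eq continuous_intros)
  ultimately have "compact (PiE UNIV (\<lambda>_::'a list. {0..1::real}) \<inter> {p. consistent p})"
    by (intro compact_Int_closed) simp_all
  moreover have "PiE UNIV (\<lambda>_::'a list. {0..1::real}) \<inter> {p. consistent p} = {p. consistent p}"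
    by (auto simp: consistent_le_1 consistent_nonneg)
  ultimately show ?thesis by simp
qed

text \<open>By \<open>ex_measure_cyl\<close> the inverse of \<open>cyl\<close> is defined on the
  whole compact set of consistent functions, and the space of measures is its continuous
  image.\<close>

lemma compact_space_weak_star: "compact_space (weak_star :: (nat \<Rightarrow> 'a::finite) measure topology)"
proof -
  define P where "P = {p :: 'a list \<Rightarrow> real. consistent p}"
  define inv where "inv p = (SOME \<mu>. \<mu> \<in> prob_measures \<and> cyl \<mu> = p)" for p :: "'a list \<Rightarrow> real"
  have inv: "inv p \<in> prob_measures" "cyl (inv p) = p" if "p \<in> P" for p
    using someI_ex[of "\<lambda>\<mu>. \<mu> \<in> prob_measures \<and> cyl \<mu> = p"] ex_measure_cyl[of p] that
    unfolding inv_def P_def by auto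
  have inv_cyl: "inv (cyl \<mu>) = \<mu>" "cyl \<mu> \<in> P" if "\<mu> \<in> prob_measures" for \<mu>
    using inv[of "cyl \<mu>"] cyl_inj[of "inv (cyl \<mu>)" \<mu>] consistent_cyl[OF that] that
    by (auto simp: P_def)
  have "continuous_map (subtopology euclidean P) weak_star inv"
    unfolding continuous_map_def
  proof (intro conjI allI impI)
    show "inv \<in> topspace (subtopology euclidean P) \<rightarrow> topspace weak_star" using inv by simp
    fix U :: "(nat \<Rightarrow> 'a) measure set" assume "openin weak_star U"
    then obtain V where V: "open V" "U = {\<mu>\<in>prob_measures. cyl \<mu> \<in> V}"
      unfolding openin_weak_star by blast
    have "{p \<in> topspace (subtopology euclidean P). inv p \<in> U} = P \<inter> V"
      unfolding V(2) using inv by auto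
    then show "openin (subtopology euclidean P) {p \<in> topspace (subtopology euclidean P). inv p \<in> U}"
      using V(1) by (simp add: openin_open_Int)
  qed
  moreover have "compactin (subtopology euclidean P) P"
    using compact_consistent by (simp add: compactin_subtopology P_def)
  ultimately have "compactin weak_star (inv ` P)" by (intro image_compactin)
  moreover have "inv ` P = prob_measures"
    using inv(1) inv_cyl by (metis (no_types, lifting) image_eqI subsetI subset_antisym image_subsetI)
  ultimately show ?thesis by (simp add: compact_space_def)
qed

lemma tendsto_fun_iff:
  fixes f :: "nat \<Rightarrow> 'b \<Rightarrow> real"
  shows "f \<longlonglongrightarrow> l \<longleftrightarrow> (\<forall>a. (\<lambda>n. f n a) \<longlonglongrightarrow> l a)"
proof -
  have "f \<longlonglongrightarrow> l \<longleftrightarrow> limitin (product_topology (\<lambda>_. euclideanreal) UNIV) f l sequentially"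
    unfolding euclidean_product_topology by simp
  then show ?thesis unfolding limitin_componentwise by simp
qed

text \<open>Sequences suffice because words are countable, which makes the space of real functions
  on them first countable.\<close>

lemma in_closure_weak_star:
  fixes S :: "(nat \<Rightarrow> 'a::finite) measure set"
  assumes "S \<subseteq> prob_measures"
  shows "\<mu> \<in> weak_star closure_of S \<longleftrightarrow> \<mu> \<in> prob_measures \<and>
    (\<exists>f. (\<forall>n. f n \<in> S) \<and> (\<forall>a. (\<lambda>n. cyl (f n) a) \<longlonglongrightarrow> cyl \<mu> a))"
proof -
  have "\<mu> \<in> weak_star closure_of S \<longleftrightarrow> \<mu> \<in> prob_measures \<and> cyl \<mu> \<in> closure (cyl ` S)"
    (is "?L \<longleftrightarrow> ?R")
  proof
    assume L: ?L
    then have \<mu>: "\<mu> \<in> prob_measures" by (simp add: in_closure_of)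
    have "\<exists>q\<in>cyl ` S. q \<in> V" if V: "open V" "cyl \<mu> \<in> V" for V
    proof -
      have "openin weak_star {\<nu>\<in>prob_measures. cyl \<nu> \<in> V}"
        unfolding openin_weak_star using V(1) by blast
      moreover have "\<mu> \<in> {\<nu>\<in>prob_measures. cyl \<nu> \<in> V}" using V(2) \<mu> by simp
      ultimately obtain \<nu> where "\<nu> \<in> S" "\<nu> \<in> {\<nu>\<in>prob_measures. cyl \<nu> \<in> V}"
        using L unfolding in_closure_of by meson
      then show ?thesis by blast
    qed
    then show ?R using \<mu> by (auto simp: closure_iff_nhds_not_empty)
  next
    assume R: ?R
    show ?L unfolding in_closure_of
    proof (intro conjI allI impI)
      show "\<mu> \<in> topspace weak_star" using R by simp
      fix T assume "\<mu> \<in> T \<and> openin weak_star T"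
      then obtain V where V: "open V" "T = {\<mu>\<in>prob_measures. cyl \<mu> \<in> V}" "cyl \<mu> \<in> V"
        unfolding openin_weak_star by blast
      then have "cyl ` S \<inter> V \<noteq> {}" using R by (auto simp: closure_iff_nhds_not_empty)
      then show "\<exists>y. y \<in> S \<and> y \<in> T" using V(2) assms by blast
    qed
  qed
  also have "cyl \<mu> \<in> closure (cyl ` S) \<longleftrightarrow> (\<exists>f. (\<forall>n. f n \<in> S) \<and> (\<lambda>n. cyl (f n)) \<longlonglongrightarrow> cyl \<mu>)"
    unfolding closure_sequential
  proof
    assume "\<exists>x. (\<forall>n. x n \<in> cyl ` S) \<and> x \<longlonglongrightarrow> cyl \<mu>"
    then obtain x where x: "\<And>n. x n \<in> cyl ` S" "x \<longlonglongrightarrow> cyl \<mu>" by blast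
    define f where "f n = (SOME \<nu>. \<nu> \<in> S \<and> cyl \<nu> = x n)" for n
    have f: "f n \<in> S \<and> cyl (f n) = x n" for n
      unfolding f_def by (rule someI_ex) (use x(1)[of n] in auto)
    then have "(\<lambda>n. cyl (f n)) = x" by simp
    with f x(2) show "\<exists>f. (\<forall>n. f n \<in> S) \<and> (\<lambda>n. cyl (f n)) \<longlonglongrightarrow> cyl \<mu>"
      by (intro exI[of _ f]) simp
  next
    assume "\<exists>f. (\<forall>n. f n \<in> S) \<and> (\<lambda>n. cyl (f n)) \<longlonglongrightarrow> cyl \<mu>"
    then obtain f where "\<forall>n. f n \<in> S" "(\<lambda>n. cyl (f n)) \<longlonglongrightarrow> cyl \<mu>" by (elim exE conjE)
    then show "\<exists>x. (\<forall>n. x n \<in> cyl ` S) \<and> x \<longlonglongrightarrow> cyl \<mu>"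
      by (intro exI[of _ "\<lambda>n. cyl (f n)"]) simp
  qed
  finally show ?thesis by (simp add: tendsto_fun_iff)
qed

text \<open>Conditional cylinder values are again consistent, so the description in
  \<open>trans_meas\<close> denotes a measure.\<close>

lemma trans_meas:
  fixes \<mu> :: "(nat \<Rightarrow> 'a::finite) measure"
  assumes \<mu>: "\<mu> \<in> prob_measures" and pos: "cyl \<mu> a > 0"
  shows "trans_meas a \<mu> \<in> prob_measures" "cyl (trans_meas a \<mu>) b = cyl \<mu> (a @ b) / cyl \<mu> a"
proof -
  have c: "consistent (cyl \<mu>)" by (rule consistent_cyl[OF \<mu>])
  have "consistent (\<lambda>b. cyl \<mu> (a @ b) / cyl \<mu> a)"
    using c pos unfolding consistent_def
    by (simp flip: sum_divide_distrib append_assoc)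
  then obtain \<nu> where \<nu>: "\<nu> \<in> prob_measures" "cyl \<nu> = (\<lambda>b. cyl \<mu> (a @ b) / cyl \<mu> a)"
    using ex_measure_cyl by blast
  have "trans_meas a \<mu> = \<nu>"
    unfolding trans_meas_def
  proof (rule the_equality)
    show "\<nu> \<in> prob_measures \<and> (\<forall>b. measure \<nu> (cylinder b) = measure \<mu> (cylinder (a @ b)) / measure \<mu> (cylinder a))"
      using \<nu> by (simp add: cyl_def fun_eq_iff)
    fix \<rho> assume "\<rho> \<in> prob_measures \<and> (\<forall>b. measure \<rho> (cylinder b) = measure \<mu> (cylinder (a @ b)) / measure \<mu> (cylinder a))"
    then show "\<rho> = \<nu>" using \<nu> by (intro cyl_inj) (auto simp: cyl_def)
  qed
  then show "trans_meas a \<mu> \<in> prob_measures" "cyl (trans_meas a \<mu>) b = cyl \<mu> (a @ b) / cyl \<mu> a"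
    using \<nu> by simp_all
qed

subsection \<open>Subshifts and words\<close>

lemma length_last_word [simp]: "length (last_word x n) = n"
  by (simp add: last_word_def)

lemma last_word_nth: "k < n \<Longrightarrow> last_word x n ! k = x (n - Suc k)"
  by (simp add: last_word_def rev_nth)

lemma last_word_eq_iff: "last_word x n = last_word y n \<longleftrightarrow> (\<forall>i<n. x i = y i)"
  by (auto simp: last_word_def map_eq_conv)

lemma last_word_Suc: "last_word x (Suc n) = x n # last_word x n"
  by (simp add: last_word_def)

lemma last_word_suffix: "n \<le> m \<Longrightarrow> \<exists>c. last_word x m = c @ last_word x n"
proof (induction m rule: dec_induct)
  case (step m)
  then show ?case by (metis append_Cons last_word_Suc)
qed simp

lemma extend_Nil [simp]: "extend x [] = x"
  by (simp add: extend_def)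

lemma extend_append: "extend x (a @ b) = extend (extend x a) b"
proof
  fix i
  have "i - length b - length a = i - (length a + length b)" by simp
  then show "extend x (a @ b) i = extend (extend x a) b i"
    by (simp add: extend_def nth_append) linarith
qed

lemma last_word_extend: "last_word (extend x b) (length b + n) = last_word x n @ b"
proof (rule nth_equalityI)
  fix k assume k: "k < length (last_word (extend x b) (length b + n))"
  show "last_word (extend x b) (length b + n) ! k = (last_word x n @ b) ! k"
  proof (cases "k < n")
    case True
    then have "\<not> length b + n - Suc k < length b" "length b + n - Suc k - length b = n - Suc k" by auto
    then show ?thesis using True k by (simp add: last_word_nth nth_append extend_def)
  next
    case False
    then have "length b + n - Suc k < length b" "length b - Suc (length b + n - Suc k) = k - n"
      using k by auto
    then show ?thesis using False k by (simp add: last_word_nth nth_append extend_def rev_nth)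
  qed
qed simp

lemma in_closure_last_word:
  fixes S :: "(nat \<Rightarrow> 'a) set"
  shows "x \<in> seq_topology closure_of S \<longleftrightarrow> (\<forall>n. \<exists>y\<in>S. last_word y n = last_word x n)"
  unfolding in_closure_seq last_word_eq_iff ..

lemma openin_last_word:
  fixes U :: "(nat \<Rightarrow> 'a) set"
  shows "openin seq_topology U \<longleftrightarrow> (\<forall>x\<in>U. \<exists>n. \<forall>y. last_word y n = last_word x n \<longrightarrow> y \<in> U)"
  unfolding openin_seq_nat last_word_eq_iff ..

section \<open>Subshifts and their languages\<close>

lemma subshift_translate:
  assumes "subshift X" "x \<in> X"
  shows "(\<lambda>i. x (i + k)) \<in> X"
proof (induction k rule: int_induct[where k = 0])
  case base
  then show ?case using assms by simp
next
  case (step1 k)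
  then have "shift (\<lambda>i. x (i + k)) \<in> X" using assms(1) by (auto simp: subshift_def)
  moreover have "shift (\<lambda>i. x (i + k)) = (\<lambda>i. x (i + (k + 1)))"
    by (simp add: shift_def ac_simps)
  ultimately show ?case by simp
next
  case (step2 k)
  then have "(\<lambda>i. x (i + k)) \<in> shift ` X" using assms(1) by (simp add: subshift_def)
  then obtain y where y: "y \<in> X" "(\<lambda>i. x (i + k)) = shift y" by blast
  have "y i = x (i + (k - 1))" for i
    using fun_cong[OF y(2), of "i - 1"] by (simp add: shift_def algebra_simps)
  then have "y = (\<lambda>i. x (i + (k - 1)))" by blast
  with y(1) show ?case by simp
qed

lemma admissible_at:
  assumes "subshift X"
  shows "admissible X w \<longleftrightarrow> (\<exists>x\<in>X. \<forall>k<length w. x (j + int k) = w ! k)"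
proof
  assume "admissible X w"
  then obtain x i where x: "x \<in> X" "\<forall>k<length w. x (i + int k) = w ! k"
    unfolding admissible_def by blast
  have "(\<lambda>l. x (l + (i - j))) \<in> X" by (rule subshift_translate[OF assms x(1)])
  moreover have "\<forall>k<length w. (\<lambda>l. x (l + (i - j))) (j + int k) = w ! k"
    using x(2) by (simp add: algebra_simps)
  ultimately show "\<exists>x\<in>X. \<forall>k<length w. x (j + int k) = w ! k" by - (rule bexI)
next
  assume "\<exists>x\<in>X. \<forall>k<length w. x (j + int k) = w ! k"
  then show "admissible X w" unfolding admissible_def by (elim bexE) (intro bexI exI[of _ j])
qed

lemma admissible_factor:
  assumes "admissible X (a @ b @ c)"
  shows "admissible X b"
proof -
  obtain x i where x: "x \<in> X" "\<forall>k<length (a @ b @ c). x (i + int k) = (a @ b @ c) ! k"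
    using assms unfolding admissible_def by blast
  have "x (i + int (length a) + int k) = b ! k" if "k < length b" for k
    using x(2)[rule_format, of "length a + k"] that by (simp add: nth_append algebra_simps)
  then show ?thesis unfolding admissible_def using x(1) by blast
qed

lemma admissible_suffix: "admissible X (a @ b) \<Longrightarrow> admissible X b"
  using admissible_factor[of X a b "[]"] by simp

lemma admissible_prefix: "admissible X (a @ b) \<Longrightarrow> admissible X a"
  using admissible_factor[of X "[]" a b] by simp

lemma admissible_extend_left:
  assumes "admissible X a"
  shows "\<exists>s. admissible X (s # a)"
proof -
  obtain x i where x: "x \<in> X" "\<forall>k<length a. x (i + int k) = a ! k"
    using assms unfolding admissible_def by blast
  have "x (i - 1 + int k) = (x (i - 1) # a) ! k" if "k < Suc (length a)" for k
    using x(2) that by (cases k) auto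
  then show ?thesis unfolding admissible_def using x(1) by (metis length_Cons)
qed

lemma mem_subshift:
  assumes "subshift X" "\<And>n. \<exists>y\<in>X. \<forall>i. \<bar>i\<bar> \<le> int n \<longrightarrow> y i = x i"
  shows "x \<in> X"
proof (rule ccontr)
  assume "x \<notin> X"
  moreover have "openin seq_topology (- X)"
    using assms(1) by (simp add: subshift_def closedin_def Compl_eq_Diff_UNIV)
  ultimately obtain F where F: "finite F" "\<And>y. (\<forall>i\<in>F. y i = x i) \<Longrightarrow> y \<in> - X"
    unfolding openin_seq by (metis ComplI)
  obtain n where n: "\<And>i. i \<in> F \<Longrightarrow> \<bar>i\<bar> \<le> int n"
  proof -
    have "\<bar>i\<bar> \<le> int (nat (Max (insert 0 (abs ` F))))" if "i \<in> F" for i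
      using F(1) that by (simp add: Max_ge le_max_iff_disj)
    then show ?thesis using that by blast
  qed
  obtain y where "y \<in> X" "\<forall>i. \<bar>i\<bar> \<le> int n \<longrightarrow> y i = x i" using assms(2) by blast
  then show False using F(2)[of y] n by blast
qed

text \<open>Each centred window of a point of \<open>Y\<close> is a word of \<open>X\<close>, hence
  occurs at the same place in a point of \<open>X\<close>; closedness of \<open>X\<close> does the
  rest. Used in both directions, this makes the language determine the subshift.\<close>

lemma subshift_subsetI:
  assumes "subshift X" "\<And>a. admissible Y a \<Longrightarrow> admissible X a"
  shows "Y \<subseteq> X"
proof
  fix x assume x: "x \<in> Y"
  show "x \<in> X"
  proof (rule mem_subshift[OF assms(1)])
    fix n
    define w where "w = map (\<lambda>k. x (- int n + int k)) [0..<2 * n + 1]"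
    have "admissible Y w"
      unfolding admissible_def w_def using x
      by (intro bexI[of _ x] exI[of _ "- int n"]) (simp_all del: upt_Suc)
    then obtain y where y: "y \<in> X" "\<forall>k<length w. y (- int n + int k) = w ! k"
      using assms admissible_at[OF assms(1), of w "- int n"] by blast
    have "y i = x i" if "\<bar>i\<bar> \<le> int n" for i
    proof -
      have "nat (i + int n) < 2 * n + 1" "- int n + int (nat (i + int n)) = i" using that by auto
      then show ?thesis using y(2)[rule_format, of "nat (i + int n)"] by (simp add: w_def del: upt_Suc)
    qed
    then show "\<exists>y\<in>X. \<forall>i. \<bar>i\<bar> \<le> int n \<longrightarrow> y i = x i" using y(1) by blast
  qed
qed

text \<open>The sequences all of whose windows lie in \<open>L\<close> form a subshift. That every
  \<open>a\<close> in \<open>L\<close> occurs in it needs a bi-infinite point, obtained by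
  prolonging \<open>a\<close> forever on both sides.\<close>

lemma ex_subshift:
  fixes L :: "'a list set"
  assumes fac: "\<And>a b c. a @ b @ c \<in> L \<Longrightarrow> b \<in> L"
    and ext: "\<And>a. a \<in> L \<Longrightarrow> \<exists>s t. s # a @ [t] \<in> L"
  shows "\<exists>X. subshift X \<and> (\<forall>a. admissible X a \<longleftrightarrow> a \<in> L)"
proof -
  define X where "X = {x :: int \<Rightarrow> 'a. \<forall>i n. map (\<lambda>k. x (i + int k)) [0..<n] \<in> L}"
  have "closedin seq_topology X"
  proof -
    have "closedin seq_topology {x :: int \<Rightarrow> 'a. map (\<lambda>k. x (i + int k)) [0..<n] \<in> L}" for i n
    proof (rule clopen_seq(2)[of "(\<lambda>k. i + int k) ` {0..<n}"])
      fix x y :: "int \<Rightarrow> 'a" assume "\<And>j. j \<in> (\<lambda>k. i + int k) ` {0..<n} \<Longrightarrow> x j = y j"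
      then have "map (\<lambda>k. x (i + int k)) [0..<n] = map (\<lambda>k. y (i + int k)) [0..<n]"
        by (intro map_cong refl) simp
      then show "x \<in> {x. map (\<lambda>k. x (i + int k)) [0..<n] \<in> L} \<longleftrightarrow> y \<in> {x. map (\<lambda>k. x (i + int k)) [0..<n] \<in> L}"
        unfolding mem_Collect_eq by (rule arg_cong)
    qed simp
    then have "closedin seq_topology (\<Inter>i. \<Inter>n. {x :: int \<Rightarrow> 'a. map (\<lambda>k. x (i + int k)) [0..<n] \<in> L})"
      by (intro closedin_INT) auto
    moreover have "X = (\<Inter>i. \<Inter>n. {x :: int \<Rightarrow> 'a. map (\<lambda>k. x (i + int k)) [0..<n] \<in> L})"
      by (auto simp: X_def)
    ultimately show ?thesis by simp
  qed
  moreover have "shift ` X = X"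
  proof -
    have tr: "(\<lambda>i. x (i + j)) \<in> X" if "x \<in> X" for x j
      unfolding X_def
    proof (intro CollectI allI)
      fix i n
      have "map (\<lambda>k. x ((i + j) + int k)) [0..<n] \<in> L" using that unfolding X_def by blast
      then show "map (\<lambda>k. x (i + int k + j)) [0..<n] \<in> L" by (simp add: ac_simps)
    qed
    have "shift x \<in> X" if "x \<in> X" for x using tr[OF that, of 1] by (simp add: shift_def)
    moreover have "x \<in> shift ` X" if "x \<in> X" for x
      using tr[OF that, of "- 1"] by (intro image_eqI[of _ _ "\<lambda>i. x (i + - 1)"]) (simp_all add: shift_def)
    ultimately show ?thesis by blast
  qed
  moreover have "a \<in> L" if "admissible X a" for a
  proof -
    obtain x i where x: "x \<in> X" "\<forall>k<length a. x (i + int k) = a ! k"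
      using \<open>admissible X a\<close> unfolding admissible_def by blast
    have "map (\<lambda>k. x (i + int k)) [0..<length a] = a"
      using x(2) by (intro nth_equalityI) simp_all
    then show ?thesis using x(1) unfolding X_def by (metis (mono_tags, lifting) mem_Collect_eq)
  qed
  moreover have "admissible X a" if a: "a \<in> L" for a
  proof -
    obtain s t where st: "\<And>b. b \<in> L \<Longrightarrow> s b # b @ [t b] \<in> L" using ext by metis
    \<comment> \<open>Each stage adds one letter on either side, so \<open>a\<close> begins at index
      \<open>n\<close> of \<open>W n\<close>. With \<open>a\<close> placed at position 0, position
      \<open>i\<close> is index \<open>i + n\<close>.\<close>
    define W where "W n = ((\<lambda>b. s b # b @ [t b]) ^^ n) a" for n
    have W_Suc: "W (Suc n) = s (W n) # W n @ [t (W n)]" and W_0: "W 0 = a" for n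
      by (simp_all add: W_def)
    have WL: "W n \<in> L" for n by (induction n) (simp_all add: W_0 W_Suc a st)
    have len: "length (W n) = length a + 2 * n" for n by (induction n) (simp_all add: W_0 W_Suc)
    have nth: "W (n + m) ! (k + m) = W n ! k" if "k < length (W n)" for n m k
    proof (induction m)
      case (Suc m)
      have "k + m < length (W (n + m))" using that by (simp add: len)
      then show ?case using Suc by (simp add: W_Suc nth_append)
    qed simp
    define N where "N i = nat \<bar>i\<bar> + 1" for i :: int
    define x where "x i = W (N i) ! nat (i + int (N i))" for i
    \<comment> \<open>Every stage that covers position \<open>i\<close> shows the same letter there;
      \<open>N i\<close> is merely one such stage.\<close>
    have x: "x i = W n ! nat (i + int n)" if "- int n \<le> i" "i < int (length a + n)" for i n
    proof (cases "N i \<le> n")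
      case True
      then obtain m where m: "n = N i + m" using le_Suc_ex by blast
      have e: "nat (i + int (N i + m)) = nat (i + int (N i)) + m" unfolding N_def by arith
      have "nat (i + int (N i)) < length (W (N i))" unfolding len N_def using that m by (simp add: N_def)
      from nth[OF this, of m] show ?thesis unfolding x_def m e ..
    next
      case False
      then have "n \<le> N i" by simp
      then obtain m where m: "N i = n + m" using le_Suc_ex by blast
      have e: "nat (i + int (n + m)) = nat (i + int n) + m" using that by arith
      have "nat (i + int n) < length (W n)" unfolding len using that by simp
      from nth[OF this, of m] show ?thesis unfolding x_def m e .
    qed
    have "x \<in> X"
      unfolding X_def
    proof (intro CollectI allI)
      fix i n
      \<comment> \<open>A stage covering the positions from \<open>i\<close> to
        \<open>i + n - 1\<close>, so that the window is a factor of a single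
        \<open>W m\<close>.\<close>
      define m where "m = nat \<bar>i\<bar> + n"
      have "map (\<lambda>k. x (i + int k)) [0..<n] = take n (drop (nat (i + int m)) (W m))"
      proof (rule nth_equalityI)
        show "length (map (\<lambda>k. x (i + int k)) [0..<n]) = length (take n (drop (nat (i + int m)) (W m)))"
          unfolding m_def by (simp add: len)
        fix k assume "k < length (map (\<lambda>k. x (i + int k)) [0..<n])"
        then have k: "k < n" by simp
        have e: "nat (i + int k + int m) = nat (i + int m) + k" unfolding m_def by arith
        have "x (i + int k) = W m ! nat (i + int k + int m)"
          by (rule x) (use k in \<open>auto simp: m_def\<close>)
        moreover have "nat (i + int m) \<le> length (W m)" 
          using abs_ge_self[of i] by (simp add: nat_le_iff len m_def)
        ultimately show "map (\<lambda>k. x (i + int k)) [0..<n] ! k = take n (drop (nat (i + int m)) (W m)) ! k"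
          using k by (simp add: e)
      qed
      moreover have "take n (drop j u) \<in> L" if "u \<in> L" for u j
        using fac[of "take j u" "take n (drop j u)" "drop n (drop j u)"] that
        by (simp only: append_take_drop_id)
      ultimately show "map (\<lambda>k. x (i + int k)) [0..<n] \<in> L" using WL by simp
    qed
    moreover have "\<forall>k<length a. x (0 + int k) = a ! k"
      using x[of 0] by (simp add: W_0)
    ultimately show ?thesis unfolding admissible_def by blast
  qed
  ultimately show ?thesis unfolding subshift_def by blast
qed

section \<open>Pasts and their continuations\<close>

lemma left_blocks_0:
  assumes "subshift X"
  shows "left_blocks X n = left_blocks X 0"
proof -
  have *: "left_blocks X m \<subseteq> left_blocks X l" for m l
    unfolding left_blocks_def
  proof
    fix z assume "z \<in> (\<lambda>x i. x (int m - int i)) ` X"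
    then obtain x where x: "x \<in> X" "z = (\<lambda>i. x (int m - int i))" by blast
    show "z \<in> (\<lambda>x i. x (int l - int i)) ` X"
      by (rule image_eqI[OF _ subshift_translate[OF assms x(1), of "int m - int l"]])
        (simp add: x(2))
  qed
  show ?thesis using * by blast
qed

text \<open>For the converse, each \<open>n\<close> provides a point of \<open>X\<close> that agrees
  with \<open>x\<close> on its last \<open>n\<close> entries; these closed sets of points are
  nested, and compactness gives one point for all \<open>n\<close>.\<close>

lemma left_blocks_iff:
  fixes X :: "(int \<Rightarrow> 'a::finite) set"
  assumes "subshift X"
  shows "x \<in> left_blocks X 0 \<longleftrightarrow> (\<forall>n. admissible X (last_word x n))"
proof
  assume "x \<in> left_blocks X 0"
  then obtain z where z: "z \<in> X" "x = (\<lambda>i. z (- int i))" unfolding left_blocks_def by auto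
  \<comment> \<open>The last \<open>n\<close> entries of a past occupy the positions from
    \<open>1 - n\<close> to 0, and \<open>last_word\<close> lists them from left to right.\<close>
  have "z (1 - int n + int k) = last_word x n ! k" if "k < n" for n k
    using that by (simp add: last_word_nth z(2) of_nat_diff algebra_simps)
  then show "\<forall>n. admissible X (last_word x n)"
    unfolding admissible_def using z(1) by (metis length_last_word)
next
  assume adm: "\<forall>n. admissible X (last_word x n)"
  define C where "C n = X \<inter> {z. \<forall>i<n. z (- int i) = x i}" for n
  have "C n \<noteq> {}" for n
  proof -
    obtain z where z: "z \<in> X" "\<forall>k<n. z (1 - int n + int k) = last_word x n ! k"
      using adm[rule_format, of n] admissible_at[OF assms, of "last_word x n" "1 - int n"] by auto
    have "z (- int i) = x i" if "i < n" for i
    proof -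
      have "1 - int n + int (n - Suc i) = - int i" "n - Suc (n - Suc i) = i" using that by (auto simp: of_nat_diff)
      then show ?thesis using z(2)[rule_format, of "n - Suc i"] that by (simp add: last_word_nth)
    qed
    then show ?thesis using z(1) by (auto simp: C_def)
  qed
  moreover have "closedin seq_topology (C n)" for n
  proof -
    have "closedin seq_topology {z :: int \<Rightarrow> 'a. \<forall>i<n. z (- int i) = x i}"
      by (rule clopen_seq(2)[of "(\<lambda>i. - int i) ` {..<n}"]) auto
    then show ?thesis unfolding C_def using assms by (auto simp: subshift_def)
  qed
  moreover have "decseq C" unfolding decseq_def C_def by (auto dest: less_le_trans)
  ultimately have "(\<Inter>n. C n) \<noteq> {}" by (intro compact_space_imp_nest[OF compact_space_seq])
  then obtain z where z: "\<And>n. z \<in> C n" by blast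
  have "x = (\<lambda>i. z (int 0 - int i))"
  proof
    fix i show "x i = z (int 0 - int i)" using z[of "Suc i"] by (simp add: C_def)
  qed
  moreover have "z \<in> X" using z[of 0] by (simp add: C_def)
  ultimately show "x \<in> left_blocks X 0" unfolding left_blocks_def by blast
qed

lemma followers_iff:
  fixes X :: "(int \<Rightarrow> 'a::finite) set"
  assumes "subshift X"
  shows "a \<in> followers X n x \<longleftrightarrow> length a = n \<and> extend x a \<in> left_blocks X 0"
  by (auto simp: followers_def left_blocks_0[OF assms, of n])

text \<open>Up to shortening on the left, the final words of (x,a) are the words
  \<open>last_word x k @ a\<close>. The condition runs over all \<open>k\<close> and need not be
  decided by a finite part of \<open>x\<close>.\<close>

lemma extend_left_blocks_iff:
  fixes X :: "(int \<Rightarrow> 'a::finite) set"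
  assumes "subshift X"
  shows "extend x a \<in> left_blocks X 0 \<longleftrightarrow> (\<forall>k. admissible X (last_word x k @ a))"
proof -
  have "(\<forall>n. admissible X (last_word (extend x a) n)) \<longleftrightarrow> (\<forall>k. admissible X (last_word x k @ a))"
  proof safe
    fix k assume "\<forall>n. admissible X (last_word (extend x a) n)"
    then show "admissible X (last_word x k @ a)" by (metis last_word_extend)
  next
    fix n assume "\<forall>k. admissible X (last_word x k @ a)"
    then have "admissible X (last_word (extend x a) (length a + n))" by (simp add: last_word_extend)
    then show "admissible X (last_word (extend x a) n)"
      using last_word_suffix[of n "length a + n" "extend x a"] admissible_suffix by (metis le_add2)
  qed
  then show ?thesis by (simp add: left_blocks_iff[OF assms])
qed

lemma left_blocks_prefix:
  fixes X :: "(int \<Rightarrow> 'a::finite) set"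
  assumes "subshift X" "extend x a \<in> left_blocks X 0"
  shows "x \<in> left_blocks X 0"
proof -
  have "admissible X (last_word x k @ a)" for k
    using assms(2) by (simp add: extend_left_blocks_iff[OF assms(1)])
  then have "admissible X (last_word x k)" for k by (rule admissible_prefix)
  then show ?thesis by (simp add: left_blocks_iff[OF assms(1)])
qed

text \<open>Baire's theorem for pasts: \<open>Q n\<close> is a property of words that every admissible word acquires
  after a suitable prolongation to the left.\<close>

lemma ex_generic_past:
  fixes X :: "(int \<Rightarrow> 'a::finite) set" and Q :: "nat \<Rightarrow> 'a list \<Rightarrow> bool"
  assumes X: "subshift X" and w: "admissible X w"
    and Q: "\<And>n u. admissible X u \<Longrightarrow> \<exists>c. admissible X (c @ u) \<and> Q n (c @ u)"
  shows "\<exists>x\<in>left_blocks X 0. last_word x (length w) = w \<and> (\<forall>n. \<exists>k. Q n (last_word x k))"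
proof -
  \<comment> \<open>One letter is added first, so that the prolongation is never empty and the words
    \<open>W n\<close> below grow without bound.\<close>
  have "\<exists>c. c \<noteq> [] \<and> admissible X (c @ u) \<and> Q n (c @ u)" if u: "admissible X u" for n u
  proof -
    obtain s where "admissible X (s # u)" using admissible_extend_left[OF u] by blast
    from Q[OF this] obtain c where "admissible X (c @ s # u)" "Q n (c @ s # u)" by blast
    then show ?thesis by (intro exI[of _ "c @ [s]"]) simp
  qed
  then have "\<forall>n u. \<exists>c. admissible X u \<longrightarrow> c \<noteq> [] \<and> admissible X (c @ u) \<and> Q n (c @ u)" by blast
  then obtain c where c: "\<And>n u. admissible X u \<Longrightarrow> c n u \<noteq> [] \<and> admissible X (c n u @ u) \<and> Q n (c n u @ u)"
    unfolding choice_iff by blast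
  define W where "W = rec_nat w (\<lambda>n u. c n u @ u)"
  have W_0: "W 0 = w" and W_Suc: "W (Suc n) = c n (W n) @ W n" for n by (simp_all add: W_def)
  have adm: "admissible X (W n)" for n by (induction n) (simp_all add: W_0 W_Suc w c)
  have len: "n \<le> length (W n)" for n
  proof (induction n)
    case (Suc n)
    have "length (c n (W n)) > 0" using c[OF adm[of n], of n] by simp
    with Suc show ?case unfolding W_Suc length_append by linarith
  qed simp
  have suf: "\<exists>d. W n = d @ W m" if "m \<le> n" for m n
    using that
  proof (induction n rule: dec_induct)
    case (step n)
    then obtain d where "W n = d @ W m" by blast
    then show ?case by (intro exI[of _ "c n (W n) @ d"]) (simp add: W_Suc)
  qed simp
  have nth: "rev (W n) ! i = rev (W m) ! i" if "m \<le> n" "i < length (W m)" for m n i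
    using suf[OF that(1)] that(2) by (auto simp: nth_append)
  \<comment> \<open>The entry at distance \<open>i\<close> from the right end is read at stage
    \<open>Suc i\<close>, whose word has more than \<open>i\<close> letters.\<close>
  define x where "x i = rev (W (Suc i)) ! i" for i
  have x: "x i = rev (W n) ! i" if "i < length (W n)" for i n
  proof (cases "n \<le> Suc i")
    case True
    then show ?thesis using nth[OF True that] by (simp add: x_def)
  next
    case False
    then show ?thesis using nth[of "Suc i" n i] len[of "Suc i"] by (simp add: x_def)
  qed
  have xW: "last_word x (length (W n)) = W n" for n
    by (rule nth_equalityI) (simp_all add: last_word_nth x[of _ n] rev_nth)
  have "admissible X (last_word x k)" for k
  proof -
    obtain d where "W k = d @ last_word x k" using last_word_suffix[OF len[of k], of x] xW[of k] by auto
    then have "admissible X (d @ last_word x k)" using adm[of k] by simp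
    then show ?thesis by (rule admissible_suffix)
  qed
  then have "x \<in> left_blocks X 0" by (simp add: left_blocks_iff[OF X])
  moreover have "last_word x (length w) = w" using xW[of 0] by (simp add: W_0)
  moreover have "Q n (last_word x (length (W (Suc n))))" for n
    unfolding xW using c[OF adm[of n], of n] by (simp add: W_Suc)
  ultimately show ?thesis by blast
qed

text \<open>For a fixed word \<open>a\<close>, the pasts that can be followed by \<open>a\<close> form a closed set which need not be
  open. A word that can be prolonged so as to exclude \<open>a\<close> is prolonged in this way; any other
  word \<open>u\<close> is treated by applying the hypothesis to \<open>u a\<close>.\<close>

lemma ex_generic_past_followers:
  fixes X :: "(int \<Rightarrow> 'a::finite) set" and R :: "nat \<Rightarrow> 'a list \<Rightarrow> bool"
  assumes X: "subshift X" and w: "admissible X w"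
    and R: "\<And>n u. admissible X u \<Longrightarrow> \<exists>c. admissible X (c @ u) \<and> R n (c @ u)"
  shows "\<exists>x\<in>left_blocks X 0. last_word x (length w) = w \<and>
    (\<forall>a. extend x a \<in> left_blocks X 0 \<longrightarrow> (\<forall>n. \<exists>k. R n (last_word (extend x a) k)))"
proof -
  \<comment> \<open>Pairs of an index and a continuation are countable, so they can be coded into
    one sequence of requirements; an inadmissible \<open>u @ a\<close> meets its requirement
    vacuously.\<close>
  define Q where "Q i u = (case from_nat i of (n, a) \<Rightarrow> admissible X (u @ a) \<longrightarrow> R n (u @ a))" for i u
  have "\<exists>c. admissible X (c @ u) \<and> Q i (c @ u)" if u: "admissible X u" for i u
  proof -
    obtain n a where na: "from_nat i = (n :: nat, a :: 'a list)" by fastforce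
    show ?thesis
    proof (cases "\<exists>c. admissible X (c @ u) \<and> \<not> admissible X (c @ u @ a)")
      case True
      then show ?thesis by (auto simp: Q_def na)
    next
      case False
      then have "admissible X (u @ a)" using u by (metis append_Nil)
      from R[OF this, of n] obtain c where c: "admissible X (c @ u @ a)" "R n (c @ u @ a)" by blast
      then have "admissible X (c @ u)" using admissible_prefix[of X "c @ u" a] by simp
      then show ?thesis using c by (auto simp: Q_def na)
    qed
  qed
  from ex_generic_past[OF X w, of Q, OF this] obtain x where x: "x \<in> left_blocks X 0"
    "last_word x (length w) = w" and Qx: "\<And>i. \<exists>k. Q i (last_word x k)" by blast
  have "\<exists>k. R n (last_word (extend x a) k)" if a: "extend x a \<in> left_blocks X 0" for a n
  proof -
    obtain k where "Q (to_nat (n, a)) (last_word x k)" using Qx by blast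
    moreover have "admissible X (last_word x k @ a)" using a by (simp add: extend_left_blocks_iff[OF X])
    ultimately have "R n (last_word x k @ a)" by (simp add: Q_def)
    then show ?thesis unfolding last_word_extend[symmetric] by blast
  qed
  with x show ?thesis by blast
qed

subsection \<open>Transition maps and vertex sets\<close>

lemma trans_meas_append:
  fixes \<mu> :: "(nat \<Rightarrow> 'a::finite) measure"
  assumes \<mu>: "\<mu> \<in> prob_measures" and pos: "cyl \<mu> (a @ b) > 0"
  shows "cyl \<mu> a > 0" "cyl (trans_meas a \<mu>) b > 0"
    "trans_meas (a @ b) \<mu> = trans_meas b (trans_meas a \<mu>)"
proof -
  show a: "cyl \<mu> a > 0"
    using consistent_append_le[OF consistent_cyl[OF \<mu>], of a b] pos by simp
  show b: "cyl (trans_meas a \<mu>) b > 0" using a pos by (simp add: trans_meas[OF \<mu> a])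
  show "trans_meas (a @ b) \<mu> = trans_meas b (trans_meas a \<mu>)"
  proof (rule cyl_inj)
    show "cyl (trans_meas (a @ b) \<mu>) = cyl (trans_meas b (trans_meas a \<mu>))"
      using a by (simp add: fun_eq_iff trans_meas[OF \<mu> pos] trans_meas[OF trans_meas(1)[OF \<mu> a] b] trans_meas(2)[OF \<mu> a])
  qed (intro trans_meas \<mu> pos a b)+
qed

lemma trans_meas_Nil:
  fixes \<mu> :: "(nat \<Rightarrow> 'a::finite) measure"
  assumes \<mu>: "\<mu> \<in> prob_measures"
  shows "trans_meas [] \<mu> = \<mu>" "cyl \<mu> [] > 0"
proof -
  have 1: "cyl \<mu> [] = 1" using consistent_cyl[OF \<mu>] by (simp add: consistent_def)
  then show pos: "cyl \<mu> [] > 0" by simp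
  show "trans_meas [] \<mu> = \<mu>"
    by (rule cyl_inj[OF trans_meas(1)[OF \<mu> pos] \<mu>]) (simp add: fun_eq_iff trans_meas(2)[OF \<mu> pos] 1)
qed

lemma trans_set_cyl: "trans_set a M = {trans_meas a \<mu> | \<mu>. \<mu> \<in> M \<and> cyl \<mu> a > 0}"
  by (simp add: trans_set_def cyl_def)

lemma trans_setI: "\<mu> \<in> M \<Longrightarrow> cyl \<mu> a > 0 \<Longrightarrow> trans_meas a \<mu> \<in> trans_set a M"
  unfolding trans_set_cyl by blast

lemma trans_setE:
  assumes "\<nu> \<in> trans_set a M"
  obtains \<mu> where "\<mu> \<in> M" "cyl \<mu> a > 0" "\<nu> = trans_meas a \<mu>"
  using assms unfolding trans_set_cyl by blast

lemma trans_set_prob: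
  fixes M :: "(nat \<Rightarrow> 'a::finite) measure set"
  assumes "M \<subseteq> prob_measures"
  shows "trans_set a M \<subseteq> prob_measures"
proof
  fix \<nu> assume "\<nu> \<in> trans_set a M"
  then obtain \<mu> where "\<mu> \<in> M" "cyl \<mu> a > 0" "\<nu> = trans_meas a \<mu>" by (rule trans_setE)
  then show "\<nu> \<in> prob_measures" using trans_meas(1) assms by blast
qed

lemma trans_set_Nil:
  fixes M :: "(nat \<Rightarrow> 'a::finite) measure set"
  assumes "M \<subseteq> prob_measures"
  shows "trans_set [] M = M"
proof -
  have "\<mu> \<in> trans_set [] M" if "\<mu> \<in> M" for \<mu>
  proof -
    have "\<mu> \<in> prob_measures" using that assms by blast
    with trans_setI[of \<mu> M "[]"] show ?thesis using that by (simp add: trans_meas_Nil)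
  qed
  moreover have "\<mu> \<in> M" if "\<mu> \<in> trans_set [] M" for \<mu>
    using that
  proof (rule trans_setE)
    fix \<nu> assume "\<nu> \<in> M" "\<mu> = trans_meas [] \<nu>"
    moreover from this have "\<nu> \<in> prob_measures" using assms by blast
    ultimately show "\<mu> \<in> M" by (simp add: trans_meas_Nil)
  qed
  ultimately show ?thesis by blast
qed

lemma trans_set_append:
  fixes M :: "(nat \<Rightarrow> 'a::finite) measure set"
  assumes M: "M \<subseteq> prob_measures"
  shows "trans_set (a @ b) M = trans_set b (trans_set a M)"
proof (intro equalityI subsetI)
  fix \<nu> assume "\<nu> \<in> trans_set (a @ b) M"
  then obtain \<mu> where \<mu>: "\<mu> \<in> M" "cyl \<mu> (a @ b) > 0" "\<nu> = trans_meas (a @ b) \<mu>"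
    by (rule trans_setE)
  have p: "\<mu> \<in> prob_measures" using \<mu>(1) M by blast
  note t = trans_meas_append[OF p \<mu>(2)]
  show "\<nu> \<in> trans_set b (trans_set a M)"
    unfolding \<mu>(3) t(3) by (intro trans_setI \<mu>(1) t(1,2))
next
  fix \<nu> assume "\<nu> \<in> trans_set b (trans_set a M)"
  then obtain \<rho> where \<rho>: "\<rho> \<in> trans_set a M" "cyl \<rho> b > 0" "\<nu> = trans_meas b \<rho>" by (rule trans_setE)
  obtain \<mu> where \<mu>: "\<mu> \<in> M" "cyl \<mu> a > 0" "\<rho> = trans_meas a \<mu>" using \<rho>(1) by (rule trans_setE)
  have p: "\<mu> \<in> prob_measures" using \<mu>(1) M by blast
  have pos: "cyl \<mu> (a @ b) > 0"
    using \<rho>(2) \<mu>(2) by (simp add: \<mu>(3) trans_meas(2)[OF p \<mu>(2)] zero_less_divide_iff)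
  show "\<nu> \<in> trans_set (a @ b) M"
    unfolding \<rho>(3) \<mu>(3) trans_meas_append(3)[OF p pos, symmetric] by (rule trans_setI[OF \<mu>(1) pos])
qed

lemma trans_set_mono: "M \<subseteq> N \<Longrightarrow> trans_set a M \<subseteq> trans_set a N"
  by (auto simp: trans_set_def)

lemma trans_set_subset:
  fixes M :: "(nat \<Rightarrow> 'a::finite) measure set"
  assumes M: "M \<subseteq> prob_measures" and tc: "transition_complete M"
  shows "trans_set a M \<subseteq> M"
proof (induction a)
  case Nil
  then show ?case using trans_set_Nil[OF M] by simp
next
  case (Cons s a)
  have "trans_set (s # a) M = trans_set a (trans_set [s] M)" using trans_set_append[OF M, of "[s]" a] by simp
  also have "\<dots> \<subseteq> trans_set a M" by (rule trans_set_mono) (use tc in \<open>auto simp: transition_complete_def\<close>)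
  finally show ?case using Cons by blast
qed

text \<open>Earlier letters act first and are absorbed by transition completeness. Hence the sets
  \<open>trans_set (last_word x I) M\<close> decrease as \<open>I\<close> grows.\<close>

lemma trans_set_suffix:
  fixes M :: "(nat \<Rightarrow> 'a::finite) measure set"
  assumes "M \<subseteq> prob_measures" "transition_complete M"
  shows "trans_set (c @ a) M \<subseteq> trans_set a M"
  unfolding trans_set_append[OF assms(1)] by (rule trans_set_mono) (rule trans_set_subset[OF assms])

lemma closure_of_prob:
  "weak_star closure_of S \<subseteq> (prob_measures :: (nat \<Rightarrow> 'a::finite) measure set)"
  using closure_of_subset_topspace[of weak_star S] by simp

lemma subset_closure_of:
  "S \<subseteq> (prob_measures :: (nat \<Rightarrow> 'a::finite) measure set) \<Longrightarrow> S \<subseteq> weak_star closure_of S"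
  by (rule closure_of_subset) simp

text \<open>Conditioning on \<open>b\<close> is continuous where \<open>b\<close> has positive
  measure. An initial segment of the approximating sequence is dropped so that its members can be
  conditioned as well.\<close>

lemma trans_meas_closure:
  fixes S :: "(nat \<Rightarrow> 'a::finite) measure set"
  assumes S: "S \<subseteq> prob_measures" and \<mu>: "\<mu> \<in> weak_star closure_of S" and pos: "cyl \<mu> b > 0"
  shows "trans_meas b \<mu> \<in> weak_star closure_of (trans_set b S)"
proof -
  have p: "\<mu> \<in> prob_measures" using \<mu> closure_of_prob by blast
  obtain f where f: "\<And>n. f n \<in> S" "\<And>a. (\<lambda>n. cyl (f n) a) \<longlonglongrightarrow> cyl \<mu> a"
    using \<mu> unfolding in_closure_weak_star[OF S] by blast
  have pf: "f n \<in> prob_measures" for n using f(1) S by blast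
  obtain N where N: "\<And>n. n \<ge> N \<Longrightarrow> cyl (f n) b > 0"
    using order_tendstoD(1)[OF f(2) pos] unfolding eventually_sequentially by blast
  have "trans_meas b (f (n + N)) \<in> trans_set b S" for n
    by (rule trans_setI) (simp_all add: f(1) N)
  moreover have "(\<lambda>n. cyl (trans_meas b (f (n + N))) a) \<longlonglongrightarrow> cyl (trans_meas b \<mu>) a" for a
  proof -
    have "(\<lambda>n. cyl (f (n + N)) (b @ a) / cyl (f (n + N)) b) \<longlonglongrightarrow> cyl \<mu> (b @ a) / cyl \<mu> b"
      using pos by (intro tendsto_divide LIMSEQ_ignore_initial_segment[OF f(2)]) simp
    then show ?thesis by (simp add: trans_meas(2)[OF p pos] trans_meas(2)[OF pf N])
  qed
  ultimately show ?thesis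
    unfolding in_closure_weak_star[OF trans_set_prob[OF S]] using trans_meas(1)[OF p pos]
    by (intro conjI exI[of _ "\<lambda>n. trans_meas b (f (n + N))"]) auto
qed

lemma trans_set_closure:
  fixes S :: "(nat \<Rightarrow> 'a::finite) measure set"
  assumes S: "S \<subseteq> prob_measures"
  shows "trans_set b (weak_star closure_of S) \<subseteq> weak_star closure_of (trans_set b S)"
proof
  fix \<nu> assume "\<nu> \<in> trans_set b (weak_star closure_of S)"
  then obtain \<mu> where "\<mu> \<in> weak_star closure_of S" "cyl \<mu> b > 0" "\<nu> = trans_meas b \<mu>"
    by (rule trans_setE)
  then show "\<nu> \<in> weak_star closure_of (trans_set b S)" using trans_meas_closure[OF S] by blast
qed

lemma closure_pos:
  fixes S :: "(nat \<Rightarrow> 'a::finite) measure set"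
  assumes S: "S \<subseteq> prob_measures" and "\<mu> \<in> weak_star closure_of S" and pos: "cyl \<mu> b > 0"
  shows "\<exists>\<nu>\<in>S. cyl \<nu> b > 0"
proof -
  have "trans_meas b \<mu> \<in> weak_star closure_of (trans_set b S)" by (rule trans_meas_closure[OF assms])
  then have "trans_set b S \<noteq> {}" by auto
  then show ?thesis unfolding trans_set_cyl by blast
qed

section \<open>The sets M(x)\<close>

text \<open>If no closure fitted into \<open>W\<close>, their parts outside \<open>W\<close> would
  be nested nonempty closed sets in a compact space, and a common point would lie in M(x) but not in
  \<open>W\<close>.\<close>

lemma past_set_shrink:
  fixes M :: "(nat \<Rightarrow> 'a::finite) measure set"
  assumes M: "M \<subseteq> prob_measures" and tc: "transition_complete M"
    and W: "openin weak_star W" "past_set M x \<subseteq> W"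
  shows "\<exists>I. weak_star closure_of (trans_set (last_word x I) M) \<subseteq> W"
proof (rule ccontr)
  assume no: "\<not> ?thesis"
  define C where "C I = weak_star closure_of (trans_set (last_word x I) M) - W" for I
  have "C I \<noteq> {}" for I using no unfolding C_def by blast
  moreover have "closedin weak_star (C I)" for I
    unfolding C_def by (rule closedin_diff[OF closedin_closure_of W(1)])
  moreover have "decseq C"
    unfolding decseq_def C_def
  proof (intro allI impI Diff_mono closure_of_mono subset_refl)
    fix m n :: nat assume "m \<le> n"
    then obtain c where "last_word x n = c @ last_word x m" using last_word_suffix by blast
    then show "trans_set (last_word x n) M \<subseteq> trans_set (last_word x m) M"
      using trans_set_suffix[OF M tc, of c "last_word x m"] by simp
  qed
  ultimately have "(\<Inter>I. C I) \<noteq> {}" by (intro compact_space_imp_nest[OF compact_space_weak_star])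
  then obtain \<mu> where \<mu>: "\<And>I. \<mu> \<in> C I" by blast
  then have "\<mu> \<in> past_set M x" unfolding past_set_def C_def by blast
  moreover have "\<mu> \<notin> W" using \<mu>[of 0] unfolding C_def by blast
  ultimately show False using W(2) by blast
qed

text \<open>This is \<open>past_set_shrink\<close> with \<open>W\<close> empty.\<close>

lemma past_set_nonempty:
  fixes M :: "(nat \<Rightarrow> 'a::finite) measure set"
  assumes M: "M \<subseteq> prob_measures" and tc: "transition_complete M"
    and pos: "\<And>I. \<exists>\<mu>\<in>M. cyl \<mu> (last_word x I) > 0"
  shows "past_set M x \<noteq> {}"
proof
  assume "past_set M x = {}"
  then obtain I where "weak_star closure_of (trans_set (last_word x I) M) = {}"
    using past_set_shrink[OF M tc, of "{}" x] by auto
  then have "trans_set (last_word x I) M = {}"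
    using subset_closure_of[OF trans_set_prob[OF M]] by blast
  then show False using pos[of I] unfolding trans_set_cyl by blast
qed

text \<open>Supplies the neighbourhoods for \<open>past_set_shrink\<close> when one-letter marginals
  are to be controlled.\<close>

lemma openin_weak_star_letters:
  fixes v :: "'a::finite \<Rightarrow> real"
  shows "openin weak_star {\<mu> \<in> prob_measures. \<forall>s. \<bar>cyl \<mu> [s] - v s\<bar> < e}"
proof -
  have "open {p :: 'a list \<Rightarrow> real. \<bar>p [s] - v s\<bar> < e}" for s
    by (intro open_Collect_less continuous_intros continuous_on_product_coordinates)
  then have "open (\<Inter>s. {p :: 'a list \<Rightarrow> real. \<bar>p [s] - v s\<bar> < e})" by (intro open_INT) auto
  then show ?thesis
    unfolding openin_weak_star by (intro exI[of _ "\<Inter>s. {p :: 'a list \<Rightarrow> real. \<bar>p [s] - v s\<bar> < e}"]) auto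
qed

section \<open>Marginals as cylinder values\<close>

lemma measurable_restrict_coord:
  "(\<lambda>y. restrict y {..<n}) \<in> measurable (seq_borel :: (nat \<Rightarrow> 'a::finite) measure) (PiM {..<n} (\<lambda>_. count_space UNIV))"
proof (rule measurable_restrict)
  fix i
  show "(\<lambda>y. y i) \<in> measurable (seq_borel :: (nat \<Rightarrow> 'a) measure) (count_space UNIV)"
  proof (rule measurableI)
    fix A :: "'a set"
    have "openin seq_topology ((\<lambda>y :: nat \<Rightarrow> 'a. y i) -` A)"
      by (rule clopen_seq(1)[of "{i}"]) auto
    then show "(\<lambda>y. y i) -` A \<inter> space seq_borel \<in> sets (seq_borel :: (nat \<Rightarrow> 'a) measure)"
      by (simp add: seq_borel_def sigma_sets.Basic)
  qed simp
qed

lemma emeasure_marginal: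
  fixes \<mu> :: "(nat \<Rightarrow> 'a::finite) measure"
  assumes \<mu>: "\<mu> \<in> prob_measures"
  shows "emeasure (marginal (length a) \<mu>) {restrict (\<lambda>i. a ! i) {..<length a}} = ennreal (cyl \<mu> a)"
proof -
  interpret prob_space \<mu> using \<mu> by (simp add: prob_measures_def)
  have sets: "sets \<mu> = sets seq_borel" and space: "space \<mu> = UNIV"
    using \<mu> sets_eq_imp_space_eq[of \<mu> seq_borel] by (auto simp: prob_measures_def)
  let ?P = "PiM {..<length a} (\<lambda>_. count_space (UNIV :: 'a set))"
  have P: "?P = count_space (PiE {..<length a} (\<lambda>_. UNIV))"
    by (rule count_space_PiM_finite) simp_all
  have meas: "(\<lambda>y. restrict y {..<length a}) \<in> measurable \<mu> ?P"
    using measurable_restrict_coord measurable_cong_sets[OF sets refl] by blast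
  have "restrict y {..<length a} = restrict (\<lambda>i. a ! i) {..<length a} \<longleftrightarrow> y \<in> cylinder a" for y
  proof
    assume eq: "restrict y {..<length a} = restrict (\<lambda>i. a ! i) {..<length a}"
    have "y i = a ! i" if "i < length a" for i
      using fun_cong[OF eq, of i] that by simp
    then show "y \<in> cylinder a" by (simp add: cylinder_def)
  next
    assume "y \<in> cylinder a"
    then show "restrict y {..<length a} = restrict (\<lambda>i. a ! i) {..<length a}"
      by (intro restrict_ext) (simp add: cylinder_def)
  qed
  then have "(\<lambda>y. restrict y {..<length a}) -` {restrict (\<lambda>i. a ! i) {..<length a}} \<inter> space \<mu> = cylinder a"
    by (simp add: space vimage_def)
  then have "emeasure (marginal (length a) \<mu>) {restrict (\<lambda>i. a ! i) {..<length a}} = emeasure \<mu> (cylinder a)"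
    unfolding marginal_def by (subst emeasure_distr[OF meas]) (simp_all add: P)
  then show ?thesis by (simp add: emeasure_eq_measure cyl_def)
qed

text \<open>A finite product of finite discrete spaces is discrete, so a marginal is determined by
  its point masses, which are cylinder values by \<open>emeasure_marginal\<close>.\<close>

lemma marginal_eq_iff:
  fixes \<mu> \<nu> :: "(nat \<Rightarrow> 'a::finite) measure"
  assumes \<mu>: "\<mu> \<in> prob_measures" and \<nu>: "\<nu> \<in> prob_measures"
  shows "marginal n \<mu> = marginal n \<nu> \<longleftrightarrow> (\<forall>a. length a = n \<longrightarrow> cyl \<mu> a = cyl \<nu> a)"
proof
  assume eq: "marginal n \<mu> = marginal n \<nu>"
  show "\<forall>a. length a = n \<longrightarrow> cyl \<mu> a = cyl \<nu> a"
  proof (intro allI impI)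
    fix a :: "'a list" assume "length a = n"
    then have "ennreal (cyl \<mu> a) = ennreal (cyl \<nu> a)"
      using emeasure_marginal[OF \<mu>, of a] emeasure_marginal[OF \<nu>, of a] eq by simp
    then show "cyl \<mu> a = cyl \<nu> a" by (simp add: consistent_nonneg[OF consistent_cyl] \<mu> \<nu>)
  qed
next
  assume eq: "\<forall>a. length a = n \<longrightarrow> cyl \<mu> a = cyl \<nu> a"
  let ?S = "PiE {..<n} (\<lambda>_. UNIV :: 'a set)"
  have P: "PiM {..<n} (\<lambda>_. count_space (UNIV :: 'a set)) = count_space ?S"
    by (rule count_space_PiM_finite) simp_all
  show "marginal n \<mu> = marginal n \<nu>"
  proof (rule measure_eqI_finite[of _ ?S])
    fix y assume "y \<in> ?S"
    then have y: "y = restrict (\<lambda>i. map y [0..<n] ! i) {..<n}"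
      by (auto simp: fun_eq_iff PiE_iff extensional_def)
    have "emeasure (marginal n \<mu>) {restrict (\<lambda>i. map y [0..<n] ! i) {..<n}} =
        emeasure (marginal n \<nu>) {restrict (\<lambda>i. map y [0..<n] ! i) {..<n}}"
      using emeasure_marginal[OF \<mu>, of "map y [0..<n]"] emeasure_marginal[OF \<nu>, of "map y [0..<n]"] eq
      by simp
    then show "emeasure (marginal n \<mu>) {y} = emeasure (marginal n \<nu>) {y}" using y by simp
  qed (simp_all add: marginal_def P finite_PiE)
qed

lemma past_set_prob:
  fixes M :: "(nat \<Rightarrow> 'a::finite) measure set"
  shows "past_set M x \<subseteq> prob_measures"
  using closure_of_prob unfolding past_set_def by blast

lemma D_meas_1_iff:
  fixes M :: "(nat \<Rightarrow> 'a::finite) measure set"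
  shows "x \<in> D_meas M 1 \<longleftrightarrow> x \<in> left_blocks (presented_subshift M) 0 \<and>
    (\<forall>\<mu>\<in>past_set M x. \<forall>\<nu>\<in>past_set M x. \<forall>s. cyl \<mu> [s] = cyl \<nu> [s])"
proof -
  have "marginal 1 \<mu> = marginal 1 \<nu> \<longleftrightarrow> (\<forall>s. cyl \<mu> [s] = cyl \<nu> [s])"
    if "\<mu> \<in> past_set M x" "\<nu> \<in> past_set M x" for \<mu> \<nu>
  proof -
    have "marginal 1 \<mu> = marginal 1 \<nu> \<longleftrightarrow> (\<forall>a. length a = 1 \<longrightarrow> cyl \<mu> a = cyl \<nu> a)"
      by (rule marginal_eq_iff) (use that past_set_prob in blast)+
    also have "\<dots> \<longleftrightarrow> (\<forall>s. cyl \<mu> [s] = cyl \<nu> [s])"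
      by (auto simp: length_Suc_conv)
    finally show ?thesis .
  qed
  then show ?thesis unfolding D_meas_def by simp
qed

lemma D_meas_inf_iff:
  fixes M :: "(nat \<Rightarrow> 'a::finite) measure set"
  shows "x \<in> D_meas_inf M \<longleftrightarrow> x \<in> left_blocks (presented_subshift M) 0 \<and>
    (\<forall>\<mu>\<in>past_set M x. \<forall>\<nu>\<in>past_set M x. \<mu> = \<nu>)"
proof
  assume "x \<in> D_meas_inf M"
  then have x: "x \<in> D_meas M n" for n by (simp add: D_meas_inf_def)
  have "\<mu> = \<nu>" if "\<mu> \<in> past_set M x" "\<nu> \<in> past_set M x" for \<mu> \<nu>
  proof (rule cyl_inj)
    show p: "\<mu> \<in> prob_measures" "\<nu> \<in> prob_measures" using that past_set_prob by blast+
    show "cyl \<mu> = cyl \<nu>"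
    proof
      fix a :: "'a list"
      have "marginal (length a) \<mu> = marginal (length a) \<nu>"
        using x[of "length a"] that unfolding D_meas_def by blast
      then show "cyl \<mu> a = cyl \<nu> a" by (simp add: marginal_eq_iff[OF p])
    qed
  qed
  moreover have "x \<in> left_blocks (presented_subshift M) 0" using x[of 0] unfolding D_meas_def by blast
  ultimately show "x \<in> left_blocks (presented_subshift M) 0 \<and> (\<forall>\<mu>\<in>past_set M x. \<forall>\<nu>\<in>past_set M x. \<mu> = \<nu>)"
    by (intro conjI ballI)
next
  assume R: "x \<in> left_blocks (presented_subshift M) 0 \<and> (\<forall>\<mu>\<in>past_set M x. \<forall>\<nu>\<in>past_set M x. \<mu> = \<nu>)"
  show "x \<in> D_meas_inf M"
    unfolding D_meas_inf_def D_meas_def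
  proof (intro INT_I CollectI conjI ballI)
    show "x \<in> left_blocks (presented_subshift M) 0" using R by (rule conjunct1)
    fix n \<mu> \<nu> assume "\<mu> \<in> past_set M x" "\<nu> \<in> past_set M x"
    then have "\<mu> = \<nu>" using R by (elim conjE) (drule bspec, assumption, drule bspec)
    then show "marginal n \<mu> = marginal n \<nu>" by (rule arg_cong)
  qed
qed

lemma g_of_value:
  fixes M :: "(nat \<Rightarrow> 'a::finite) measure set"
  assumes x: "x \<in> D_meas M 1" and \<mu>: "\<mu> \<in> past_set M x"
  shows "gval (g_of M) x s = cyl \<mu> [s]"
proof -
  have "(SOME \<mu>. \<mu> \<in> past_set M x) \<in> past_set M x" using \<mu> by (rule someI)
  then have "cyl (SOME \<mu>. \<mu> \<in> past_set M x) [s] = cyl \<mu> [s]" using x \<mu> unfolding D_meas_1_iff by blast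
  then show ?thesis using x by (simp add: g_of_def cyl_def)
qed

lemma dom_g_of: "dom (g_of M) = D_meas M 1"
  by (auto simp: g_of_def dom_def)

section \<open>The presented subshift\<close>

lemma presented_subshift_eqI:
  assumes X: "subshift X" and L: "\<And>a. admissible X a \<longleftrightarrow> (\<exists>\<mu>\<in>M. cyl \<mu> a > 0)"
  shows "presented_subshift M = X"
  unfolding presented_subshift_def
proof (rule the_equality)
  show "subshift X \<and> (\<forall>a. admissible X a \<longleftrightarrow> (\<exists>\<mu>\<in>M. measure \<mu> (cylinder a) > 0))"
    using X L by (simp add: cyl_def)
  fix Y assume Y: "subshift Y \<and> (\<forall>a. admissible Y a \<longleftrightarrow> (\<exists>\<mu>\<in>M. measure \<mu> (cylinder a) > 0))"
  then have "admissible Y a \<longleftrightarrow> admissible X a" for a using L by (simp add: cyl_def)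
  then show "Y = X" using subshift_subsetI[of X Y] subshift_subsetI[of Y X] X Y by blast
qed

text \<open>Transition completeness allows letters to be dropped at the front of a word, condition
  (I) allows one to be put there, and consistency of cylinder values allows one to be added at the
  end. So \<open>ex_subshift\<close> applies to the words of positive measure.\<close>

lemma presented_subshift:
  fixes M :: "(nat \<Rightarrow> 'a::finite) measure set"
  assumes M: "M \<subseteq> prob_measures" and tc: "transition_complete M" and I: "condition_I M"
  shows "subshift (presented_subshift M)" "admissible (presented_subshift M) a \<longleftrightarrow> (\<exists>\<mu>\<in>M. cyl \<mu> a > 0)"
proof -
  define L where "L = {a. \<exists>\<mu>\<in>M. cyl \<mu> a > 0}"
  have pre: "a \<in> L" if "a @ b \<in> L" for a b
  proof -
    obtain \<mu> where \<mu>: "\<mu> \<in> M" "cyl \<mu> (a @ b) > 0"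
      using \<open>a @ b \<in> L\<close> unfolding L_def by blast
    then have "cyl \<mu> a > 0" using M by (intro trans_meas_append(1)[of \<mu> a b]) auto
    then show ?thesis using \<mu>(1) unfolding L_def by blast
  qed
  have suf: "b \<in> L" if "a @ b \<in> L" for a b
  proof -
    obtain \<mu> where \<mu>: "\<mu> \<in> M" "cyl \<mu> (a @ b) > 0"
      using \<open>a @ b \<in> L\<close> unfolding L_def by blast
    then have p: "\<mu> \<in> prob_measures" using M by blast
    have "trans_meas a \<mu> \<in> trans_set a M" by (intro trans_setI \<mu>(1) trans_meas_append(1)[OF p \<mu>(2)])
    then have "trans_meas a \<mu> \<in> M" using trans_set_subset[OF M tc] by blast
    then show ?thesis unfolding L_def using trans_meas_append(2)[OF p \<mu>(2)] by blast
  qed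
  have right: "\<exists>t. a @ [t] \<in> L" if "a \<in> L" for a
  proof -
    obtain \<mu> where \<mu>: "\<mu> \<in> M" "cyl \<mu> a > 0" using \<open>a \<in> L\<close> unfolding L_def by blast
    then have c: "consistent (cyl \<mu>)" using consistent_cyl M by blast
    have "\<exists>t. cyl \<mu> (a @ [t]) > 0"
    proof (rule ccontr)
      assume "\<not> ?thesis"
      then have "cyl \<mu> (a @ [t]) = 0" for t using consistent_nonneg[OF c, of "a @ [t]"] by (metis less_eq_real_def)
      then show False using c \<mu>(2) unfolding consistent_def by (metis less_irrefl sum.neutral)
    qed
    then show ?thesis using \<mu>(1) unfolding L_def by blast
  qed
  have left: "\<exists>s. s # a \<in> L" if "a \<in> L" for a
  proof -
    obtain \<mu> where \<mu>: "\<mu> \<in> M" "cyl \<mu> a > 0" using \<open>a \<in> L\<close> unfolding L_def by blast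
    have "\<mu> \<in> weak_star closure_of (\<Union>\<alpha>. trans_set [\<alpha>] M)" using \<mu>(1) I unfolding condition_I_def by simp
    moreover have "(\<Union>\<alpha>. trans_set [\<alpha>] M) \<subseteq> prob_measures" using trans_set_prob[OF M] by blast
    ultimately obtain \<nu> s where "\<nu> \<in> trans_set [s] M" "cyl \<nu> a > 0" using closure_pos \<mu>(2) by blast
    then obtain \<rho> where \<rho>: "\<rho> \<in> M" "cyl \<rho> [s] > 0" "cyl (trans_meas [s] \<rho>) a > 0" by (auto elim: trans_setE)
    then have p: "\<rho> \<in> prob_measures" using M by blast
    have "cyl \<rho> (s # a) > 0" using \<rho> by (simp add: trans_meas(2)[OF p \<rho>(2)] zero_less_divide_iff)
    then show ?thesis using \<rho>(1) unfolding L_def by blast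
  qed
  have "\<exists>X. subshift X \<and> (\<forall>a. admissible X a \<longleftrightarrow> a \<in> L)"
  proof (rule ex_subshift)
    show "b \<in> L" if "a @ b @ c \<in> L" for a b c using suf[OF that] by (rule pre)
    show "\<exists>s t. s # a @ [t] \<in> L" if "a \<in> L" for a
      using right[OF that] left by blast
  qed
  then obtain X where X: "subshift X" "\<And>a. admissible X a \<longleftrightarrow> (\<exists>\<mu>\<in>M. cyl \<mu> a > 0)" unfolding L_def by blast
  have "presented_subshift M = X" by (rule presented_subshift_eqI[OF X])
  then show "subshift (presented_subshift M)" "admissible (presented_subshift M) a \<longleftrightarrow> (\<exists>\<mu>\<in>M. cyl \<mu> a > 0)"
    using X by simp_all
qed

text \<open>The final word of (x,a) of length \<open>length a + I\<close> is a final word of x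
  followed by \<open>a\<close>, so conditioning on it means conditioning on the former and then on
  \<open>a\<close>. Shorter final words are reached by discarding a prefix \<open>c\<close> with
  \<open>trans_set_suffix\<close>.\<close>

lemma past_set_trans:
  fixes M :: "(nat \<Rightarrow> 'a::finite) measure set"
  assumes M: "M \<subseteq> prob_measures" and tc: "transition_complete M"
    and \<mu>: "\<mu> \<in> past_set M x" and pos: "cyl \<mu> a > 0"
  shows "trans_meas a \<mu> \<in> past_set M (extend x a)"
  unfolding past_set_def
proof
  fix I
  obtain c where c: "last_word (extend x a) (length a + I) = c @ last_word (extend x a) I"
    using last_word_suffix[of I "length a + I"] by auto
  have "trans_meas a \<mu> \<in> weak_star closure_of (trans_set a (trans_set (last_word x I) M))"
    using \<mu> unfolding past_set_def by (intro trans_meas_closure trans_set_prob M pos) blast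
  also have "trans_set a (trans_set (last_word x I) M) = trans_set (c @ last_word (extend x a) I) M"
    by (simp only: trans_set_append[OF M, symmetric] last_word_extend[symmetric] c)
  also have "weak_star closure_of \<dots> \<subseteq> weak_star closure_of (trans_set (last_word (extend x a) I) M)"
    by (rule closure_of_mono) (rule trans_set_suffix[OF M tc])
  finally show "trans_meas a \<mu> \<in> weak_star closure_of (trans_set (last_word (extend x a) I) M)" .
qed

lemma past_set_nonempty_imp:
  fixes M :: "(nat \<Rightarrow> 'a::finite) measure set"
  assumes "past_set M x \<noteq> {}"
  shows "\<exists>\<mu>\<in>M. cyl \<mu> (last_word x I) > 0"
proof -
  obtain \<mu> where "\<mu> \<in> past_set M x" using assms by blast
  then have "\<mu> \<in> weak_star closure_of (trans_set (last_word x I) M)" unfolding past_set_def by blast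
  then have "trans_set (last_word x I) M \<noteq> {}" by auto
  then show ?thesis unfolding trans_set_cyl by blast
qed

subsection \<open>Measures prescribed by a g-function\<close>

lemma followers_length_iff:
  fixes X :: "(int \<Rightarrow> 'a::finite) set"
  assumes "subshift X"
  shows "a \<in> followers X (length a) x \<longleftrightarrow> extend x a \<in> left_blocks X 0"
  using followers_iff[OF assms] by simp

lemma D_g_inf_iff:
  fixes X :: "(int \<Rightarrow> 'a::finite) set"
  assumes "subshift X"
  shows "x \<in> D_g_inf X g \<longleftrightarrow> x \<in> dom g \<and> (\<forall>a. extend x a \<in> left_blocks X 0 \<longrightarrow> extend x a \<in> dom g)"
  unfolding D_g_inf_def Ball_def followers_iff[OF assms] by blast

text \<open>The values prescribed in \<open>mu_inf\<close>, kept as a function of words because they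
  make sense before a measure with these values is known to exist.\<close>

definition word_prob :: "(int \<Rightarrow> 'a) set \<Rightarrow> 'a gfun \<Rightarrow> (nat \<Rightarrow> 'a) \<Rightarrow> 'a list \<Rightarrow> real" where
  "word_prob X g x a = (if extend x a \<in> left_blocks X 0
     then \<Prod>k<length a. gval g (extend x (take k a)) (a ! k) else 0)"

lemma word_prob_snoc:
  fixes X :: "(int \<Rightarrow> 'a::finite) set"
  assumes X: "subshift X"
  shows "word_prob X g x (a @ [s]) = word_prob X g x a *
    (if extend x (a @ [s]) \<in> left_blocks X 0 then gval g (extend x a) s else 0)"
proof (cases "extend x (a @ [s]) \<in> left_blocks X 0")
  case True
  then have "extend x a \<in> left_blocks X 0"
    using left_blocks_prefix[OF X, of "extend x a" "[s]"] by (simp add: extend_append)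
  with True show ?thesis by (simp add: word_prob_def nth_append)
next
  case False
  then show ?thesis by (simp add: word_prob_def)
qed

lemma mu_inf_eqI:
  fixes X :: "(int \<Rightarrow> 'a::finite) set"
  assumes X: "subshift X" and \<mu>: "\<mu> \<in> prob_measures" and cyl: "cyl \<mu> = word_prob X g x"
  shows "mu_inf X g x = \<mu>"
  unfolding mu_inf_def
proof (rule the_equality)
  show "\<mu> \<in> prob_measures \<and> (\<forall>a. measure \<mu> (cylinder a) =
        (if a \<in> followers X (length a) x then \<Prod>k<length a. gval g (extend x (take k a)) (a ! k) else 0))"
    using \<mu> fun_cong[OF cyl] by (simp add: cyl_def word_prob_def followers_length_iff[OF X])
  fix \<nu> assume \<nu>: "\<nu> \<in> prob_measures \<and> (\<forall>a. measure \<nu> (cylinder a) =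
        (if a \<in> followers X (length a) x then \<Prod>k<length a. gval g (extend x (take k a)) (a ! k) else 0))"
  show "\<nu> = \<mu>"
  proof (rule cyl_inj[OF _ \<mu>])
    show "\<nu> \<in> prob_measures" using \<nu> by (rule conjunct1)
    show "cyl \<nu> = cyl \<mu>"
      unfolding cyl using \<nu> by (simp add: cyl_def word_prob_def followers_length_iff[OF X] fun_eq_iff)
  qed
qed

subsection \<open>From vertex sets to g-functions and back\<close>

context
  fixes M :: "(nat \<Rightarrow> 'a::finite) measure set" and X g
  assumes rc: "residually_contractive M"
  defines "X \<equiv> presented_subshift M" and "g \<equiv> g_of M"
begin

lemma rc_prob: "M \<subseteq> prob_measures"
  and rc_tc: "transition_complete M"
  and rc_I: "M = weak_star closure_of (\<Union>\<alpha>. trans_set [\<alpha>] M)"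
  using rc by (simp_all add: residually_contractive_def condition_I_def)

lemma rc_subshift: "subshift X"
  and rc_admissible: "admissible X a \<longleftrightarrow> (\<exists>\<mu>\<in>M. cyl \<mu> a > 0)"
  unfolding X_def using rc presented_subshift[of M] by (simp_all add: residually_contractive_def)

lemma rc_dense:
  assumes "x \<in> left_blocks X 0"
  shows "\<exists>z\<in>D_meas_inf M. last_word z n = last_word x n"
proof -
  have "x \<in> seq_topology closure_of (D_meas_inf M)"
    using rc assms by (simp add: residually_contractive_def X_def)
  then show ?thesis unfolding in_closure_last_word by blast
qed

lemma rc_closed: "weak_star closure_of M = M"
  by (metis closure_of_closure_of rc_I)

lemma rc_past_subset: "past_set M x \<subseteq> M"
proof
  fix \<mu> assume "\<mu> \<in> past_set M x"
  then have "\<mu> \<in> weak_star closure_of (trans_set (last_word x 0) M)" unfolding past_set_def by blast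
  then show "\<mu> \<in> M" by (simp add: last_word_def trans_set_Nil[OF rc_prob] rc_closed)
qed

lemma rc_past_nonempty:
  assumes "x \<in> left_blocks X 0"
  shows "past_set M x \<noteq> {}"
  using assms rc_admissible unfolding left_blocks_iff[OF rc_subshift]
  by (intro past_set_nonempty rc_prob rc_tc) blast

lemma left_blocks_past_nonempty:
  assumes "past_set M x \<noteq> {}"
  shows "x \<in> left_blocks X 0"
  unfolding left_blocks_iff[OF rc_subshift] rc_admissible
  using past_set_nonempty_imp[OF assms] by blast

text \<open>Chain rule: the measure of \<open>a @ [s]\<close> is that of \<open>a\<close> times the
  value at \<open>s\<close> of the conditioned measure, which lies in M((x,a)) and so has the letter
  marginals given by \<open>g\<close>. If (x,a,s) is no past of \<open>X\<close>, its measure is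
  zero, as a positive one would make M((x,a,s)) nonempty. If \<open>a\<close> has measure zero, both
  sides vanish.\<close>

lemma past_set_cyl:
  assumes x: "x \<in> D_g_inf X g" and \<mu>: "\<mu> \<in> past_set M x"
  shows "cyl \<mu> a = word_prob X g x a"
proof -
  have p: "\<mu> \<in> prob_measures" using \<mu> past_set_prob by blast
  show ?thesis
  proof (induction a rule: rev_induct)
    case Nil
    have "x \<in> left_blocks X 0" by (rule left_blocks_past_nonempty) (use \<mu> in blast)
    then show ?case using consistent_cyl[OF p] by (simp add: consistent_def word_prob_def)
  next
    case (snoc s a)
    have ext: "extend x b \<in> left_blocks X 0" "trans_meas b \<mu> \<in> past_set M (extend x b)" if "cyl \<mu> b > 0" for b
    proof -
      show t: "trans_meas b \<mu> \<in> past_set M (extend x b)"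
        by (rule past_set_trans[OF rc_prob rc_tc \<mu> that])
      show "extend x b \<in> left_blocks X 0" by (rule left_blocks_past_nonempty) (use t in blast)
    qed
    have nonneg: "0 \<le> cyl \<mu> b" for b by (rule consistent_nonneg[OF consistent_cyl[OF p]])
    have le: "cyl \<mu> (a @ [s]) \<le> cyl \<mu> a" by (rule consistent_snoc_le[OF consistent_cyl[OF p]])
    show ?case
    proof (cases "extend x (a @ [s]) \<in> left_blocks X 0")
      case False
      then have "cyl \<mu> (a @ [s]) = 0" using ext(1)[of "a @ [s]"] nonneg[of "a @ [s]"] by linarith
      then show ?thesis using False by (simp add: word_prob_def)
    next
      case True
      then have rhs: "word_prob X g x (a @ [s]) = cyl \<mu> a * gval g (extend x a) s"
        by (simp add: word_prob_snoc[OF rc_subshift] snoc)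
      show ?thesis
      proof (cases "cyl \<mu> a > 0")
        case False
        then have "cyl \<mu> a = 0" "cyl \<mu> (a @ [s]) = 0" using le nonneg[of a] nonneg[of "a @ [s]"] by linarith+
        then show ?thesis using rhs by simp
      next
        case pos: True
        have "extend x a \<in> D_meas M 1"
          using x ext(1)[OF pos] by (simp add: D_g_inf_iff[OF rc_subshift] g_def dom_g_of)
        from g_of_value[OF this ext(2)[OF pos], of s]
        have "gval g (extend x a) s = cyl \<mu> (a @ [s]) / cyl \<mu> a"
          by (simp add: g_def trans_meas(2)[OF p pos])
        then show ?thesis using rhs pos by simp
      qed
    qed
  qed
qed

lemma past_set_generic:
  assumes x: "x \<in> D_g_inf X g"
  shows "past_set M x = {mu_inf X g x}"
proof -
  have "x \<in> D_meas M 1" using x by (simp add: D_g_inf_iff[OF rc_subshift] g_def dom_g_of)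
  then have "x \<in> left_blocks X 0" unfolding D_meas_1_iff X_def by blast
  then have ne: "past_set M x \<noteq> {}" by (rule rc_past_nonempty)
  have "\<mu> = mu_inf X g x" if \<mu>: "\<mu> \<in> past_set M x" for \<mu>
    by (rule mu_inf_eqI[OF rc_subshift, symmetric])
      (use \<mu> past_set_prob past_set_cyl[OF x \<mu>] in \<open>auto simp: fun_eq_iff\<close>)
  with ne show ?thesis by blast
qed

lemma past_set_D_meas_inf:
  assumes x: "x \<in> D_meas_inf M"
  shows "past_set M x = {past_meas M x}"
proof -
  have "x \<in> left_blocks X 0" using x unfolding D_meas_inf_iff X_def by (rule conjunct1)
  then obtain \<mu> where \<mu>: "\<mu> \<in> past_set M x" using rc_past_nonempty by blast
  have uniq: "\<nu> = \<mu>" if "\<nu> \<in> past_set M x" for \<nu>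
    using x \<mu> that unfolding D_meas_inf_iff by (elim conjE) (drule bspec, assumption, drule bspec)
  have "past_meas M x = \<mu>" unfolding past_meas_def using \<mu> uniq by (rule the_equality)
  then show ?thesis using \<mu> uniq by blast
qed

lemma ex_past_admissible:
  assumes "admissible X w"
  shows "\<exists>x\<in>left_blocks X 0. last_word x (length w) = w"
  using ex_generic_past[OF rc_subshift assms, of "\<lambda>_ _. True"] by (metis append_Nil assms)

text \<open>\<open>R n\<close> concerns all measures available after a word, so it bounds the past
  set of every past ending in that word. It can be achieved by prolonging along a past
  \<open>z\<close> in \<open>D_meas_inf M\<close>, whose past set is one point, and shrinking.
  Achieved for all \<open>n\<close> along every continuation, it forces the letter marginals there
  to agree.\<close>

lemma D_g_inf_dense:
  assumes w: "admissible X w"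
  shows "\<exists>x\<in>D_g_inf X g. last_word x (length w) = w"
proof -
  define R where "R n u \<longleftrightarrow> (\<forall>\<mu>\<in>weak_star closure_of (trans_set u M). \<forall>\<nu>\<in>weak_star closure_of (trans_set u M).
    \<forall>s. \<bar>cyl \<mu> [s] - cyl \<nu> [s]\<bar> < 1 / real (Suc n))" for n u
  have "\<exists>c. admissible X (c @ u) \<and> R n (c @ u)" if u: "admissible X u" for n u
  proof -
    obtain y where y: "y \<in> left_blocks X 0" "last_word y (length u) = u" using ex_past_admissible[OF u] by blast
    obtain z where z: "z \<in> D_meas_inf M" "last_word z (length u) = u" using rc_dense[OF y(1)] y(2) by metis
    \<comment> \<open>Half the bound in \<open>R n\<close>, since two measures are compared through
      the measure of \<open>z\<close>.\<close>
    define e where "e = 1 / (2 * real (Suc n))"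
    define W where "W = {\<mu> \<in> prob_measures. \<forall>s. \<bar>cyl \<mu> [s] - cyl (past_meas M z) [s]\<bar> < e}"
    have "past_meas M z \<in> prob_measures" using past_set_D_meas_inf[OF z(1)] past_set_prob[of M z] by blast
    then have "past_set M z \<subseteq> W" unfolding past_set_D_meas_inf[OF z(1)] W_def e_def by simp
    moreover have "openin weak_star W" unfolding W_def by (rule openin_weak_star_letters)
    ultimately obtain I where I: "weak_star closure_of (trans_set (last_word z I) M) \<subseteq> W"
      using past_set_shrink[OF rc_prob rc_tc] by blast
    \<comment> \<open>Long enough both to end in \<open>u\<close> and to have
      \<open>last_word z I\<close> as a suffix.\<close>
    obtain c where c: "last_word z (I + length u) = c @ u"
      using last_word_suffix[of "length u" "I + length u" z] z(2) by auto
    obtain d where d: "last_word z (I + length u) = d @ last_word z I"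
      using last_word_suffix[of I "I + length u" z] by auto
    have "weak_star closure_of (trans_set (c @ u) M) \<subseteq> weak_star closure_of (trans_set (last_word z I) M)"
      unfolding c[symmetric] d by (intro closure_of_mono trans_set_suffix rc_prob rc_tc)
    then have sub: "weak_star closure_of (trans_set (c @ u) M) \<subseteq> W" using I by blast
    have "R n (c @ u)"
      unfolding R_def
    proof (intro ballI allI)
      fix \<mu> \<nu> s assume "\<mu> \<in> weak_star closure_of (trans_set (c @ u) M)" "\<nu> \<in> weak_star closure_of (trans_set (c @ u) M)"
      then have "\<bar>cyl \<mu> [s] - cyl (past_meas M z) [s]\<bar> < e" "\<bar>cyl \<nu> [s] - cyl (past_meas M z) [s]\<bar> < e"
        using sub unfolding W_def by blast+
      moreover have "2 * e = 1 / real (Suc n)" by (simp add: e_def field_simps)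
      ultimately show "\<bar>cyl \<mu> [s] - cyl \<nu> [s]\<bar> < 1 / real (Suc n)" by linarith
    qed
    moreover have "z \<in> left_blocks X 0" using z(1) unfolding D_meas_inf_iff X_def by (rule conjunct1)
    then have "admissible X (c @ u)" unfolding c[symmetric] by (simp add: left_blocks_iff[OF rc_subshift])
    ultimately show ?thesis by blast
  qed
  from ex_generic_past_followers[OF rc_subshift w, of R, OF this]
  obtain x where x: "x \<in> left_blocks X 0" "last_word x (length w) = w"
    and Rx: "\<And>a n. extend x a \<in> left_blocks X 0 \<Longrightarrow> \<exists>k. R n (last_word (extend x a) k)" by blast
  have "extend x a \<in> D_meas M 1" if a: "extend x a \<in> left_blocks X 0" for a
    unfolding D_meas_1_iff
  proof (intro conjI ballI allI)
    show "extend x a \<in> left_blocks (presented_subshift M) 0" using a unfolding X_def .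
    fix \<mu> \<nu> s assume \<mu>: "\<mu> \<in> past_set M (extend x a)" and \<nu>: "\<nu> \<in> past_set M (extend x a)"
    have lt: "\<bar>cyl \<mu> [s] - cyl \<nu> [s]\<bar> < 1 / real (Suc n)" for n
    proof -
      obtain k where "R n (last_word (extend x a) k)" using Rx[OF a] by blast
      moreover have "\<mu> \<in> weak_star closure_of (trans_set (last_word (extend x a) k) M)"
        "\<nu> \<in> weak_star closure_of (trans_set (last_word (extend x a) k) M)"
        using \<mu> \<nu> unfolding past_set_def by blast+
      ultimately show ?thesis unfolding R_def by blast
    qed
    show "cyl \<mu> [s] = cyl \<nu> [s]"
    proof (rule ccontr)
      assume "cyl \<mu> [s] \<noteq> cyl \<nu> [s]"
      then obtain n where "1 / real (Suc n) < \<bar>cyl \<mu> [s] - cyl \<nu> [s]\<bar>"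
        using nat_approx_posE[of "\<bar>cyl \<mu> [s] - cyl \<nu> [s]\<bar>"] by auto
      then show False using lt[of n] by simp
    qed
  qed
  then have "x \<in> D_g_inf X g"
    using x(1) extend_Nil[of x] by (simp add: D_g_inf_iff[OF rc_subshift] g_def dom_g_of) (metis extend_Nil)
  then show ?thesis using x(2) by blast
qed

text \<open>By condition (I), \<open>\<mu>\<close> lies for every \<open>n\<close> in the closure of \<open>trans_set a M\<close> for one of the finitely
  many words \<open>a\<close> of length \<open>n\<close>; compactness provides a past whose final words all have this property.\<close>

lemma ex_past_of:
  assumes \<mu>: "\<mu> \<in> M"
  shows "\<exists>x. \<mu> \<in> past_set M x"
proof -
  define U where "U n = (\<Union>a\<in>{a. length a = n}. trans_set a M)" for n
  have U_prob: "U n \<subseteq> prob_measures" for n unfolding U_def using trans_set_prob[OF rc_prob] by blast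
  \<comment> \<open>The inclusion for \<open>n\<close> is substituted into the right side of (I);
    the extra conditioning appends one letter to the words of length \<open>n\<close>.\<close>
  have MU: "M \<subseteq> weak_star closure_of (U n)" for n
  proof (induction n)
    case 0
    show ?case using rc_closed by (simp add: U_def trans_set_Nil[OF rc_prob])
  next
    case (Suc n)
    have "trans_set [s] M \<subseteq> weak_star closure_of (U (Suc n))" for s
    proof -
      have "trans_set [s] M \<subseteq> trans_set [s] (weak_star closure_of (U n))" by (rule trans_set_mono[OF Suc])
      also have "\<dots> \<subseteq> weak_star closure_of (trans_set [s] (U n))" by (rule trans_set_closure[OF U_prob])
      also have "\<dots> \<subseteq> weak_star closure_of (U (Suc n))"
      proof (rule closure_of_mono, rule subsetI)
        fix \<nu> assume "\<nu> \<in> trans_set [s] (U n)"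
        then obtain \<rho> where \<rho>: "\<rho> \<in> U n" "cyl \<rho> [s] > 0" "\<nu> = trans_meas [s] \<rho>" by (rule trans_setE)
        then obtain a where a: "length a = n" "\<rho> \<in> trans_set a M" unfolding U_def by blast
        have "\<nu> \<in> trans_set (a @ [s]) M"
          unfolding trans_set_append[OF rc_prob] \<rho>(3) by (rule trans_setI[OF a(2) \<rho>(2)])
        then show "\<nu> \<in> U (Suc n)" unfolding U_def using a(1) by force
      qed
      finally show ?thesis .
    qed
    then have "weak_star closure_of (\<Union>s. trans_set [s] M) \<subseteq> weak_star closure_of (U (Suc n))"
      by (intro closure_of_minimal) auto
    then show ?case using rc_I by simp
  qed
  define C where "C n = {x. \<mu> \<in> weak_star closure_of (trans_set (last_word x n) M)}" for n
  have "C n \<noteq> {}" for n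
  proof -
    have "weak_star closure_of (U n) = (\<Union>a\<in>{a. length a = n}. weak_star closure_of (trans_set a M))"
      unfolding U_def by (subst closure_of_Union) (auto simp: finite_words)
    then obtain a where a: "length a = n" "\<mu> \<in> weak_star closure_of (trans_set a M)"
      using MU[of n] \<mu> by blast
    \<comment> \<open>Membership in \<open>C n\<close> concerns the last \<open>n\<close> entries
      only, so an arbitrary letter fills the past beyond \<open>a\<close>.\<close>
    have "last_word (extend (\<lambda>_. undefined) a) n = a"
      using last_word_extend[of "\<lambda>_. undefined" a 0] a(1) by (simp add: last_word_def)
    then have "extend (\<lambda>_. undefined) a \<in> C n" using a(2) unfolding C_def by simp
    then show ?thesis by blast
  qed
  moreover have "closedin seq_topology (C n)" for n
  proof (rule clopen_seq(2)[of "{..<n}"])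
    fix x y :: "nat \<Rightarrow> 'a" assume "\<And>i. i \<in> {..<n} \<Longrightarrow> x i = y i"
    then have "last_word x n = last_word y n" by (simp add: last_word_eq_iff)
    then show "x \<in> C n \<longleftrightarrow> y \<in> C n" unfolding C_def by simp
  qed simp
  moreover have "decseq C"
    unfolding decseq_def C_def
  proof (intro allI impI Collect_mono)
    fix m n x assume "(m :: nat) \<le> n" "\<mu> \<in> weak_star closure_of (trans_set (last_word x n) M)"
    moreover obtain c where "last_word x n = c @ last_word x m" using last_word_suffix[OF \<open>m \<le> n\<close>] by blast
    ultimately show "\<mu> \<in> weak_star closure_of (trans_set (last_word x m) M)"
      using closure_of_mono[OF trans_set_suffix[OF rc_prob rc_tc, of c "last_word x m"]] by fastforce
  qed
  ultimately have "(\<Inter>n. C n) \<noteq> {}" by (intro compact_space_imp_nest[OF compact_space_seq])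
  then obtain x where "\<And>n. x \<in> C n" by blast
  then have "\<mu> \<in> past_set M x" unfolding past_set_def C_def by blast
  then show ?thesis by blast
qed

section \<open>Density of the prescribed measures in M\<close>

text \<open>Each element of M lies in some M(x) by \<open>ex_past_of\<close>, and (III) is applied
  at that x.\<close>

lemma M_subset_closure: "M \<subseteq> weak_star closure_of (past_meas M ` D_meas_inf M)"
proof
  fix \<mu> assume "\<mu> \<in> M"
  then obtain x where x: "\<mu> \<in> past_set M x" using ex_past_of by blast
  have "x \<in> left_blocks X 0" by (rule left_blocks_past_nonempty) (use x in blast)
  then obtain xs where xs: "\<And>k::nat. xs k \<in> D_meas_inf M"
    and lim: "limitin weak_star (\<lambda>k. past_meas M (xs k)) \<mu> sequentially"
    using rc x unfolding residually_contractive_def X_def by blast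
  show "\<mu> \<in> weak_star closure_of (past_meas M ` D_meas_inf M)"
    unfolding in_closure_of
  proof (intro conjI allI impI)
    show "\<mu> \<in> topspace weak_star" using lim unfolding limitin_sequentially by blast
    fix T assume "\<mu> \<in> T \<and> openin weak_star T"
    then obtain N where "\<And>n. N \<le> n \<Longrightarrow> past_meas M (xs n) \<in> T" using lim unfolding limitin_sequentially by meson
    then have "past_meas M (xs N) \<in> T" by simp
    then show "\<exists>y. y \<in> past_meas M ` D_meas_inf M \<and> y \<in> T" using xs by blast
  qed
qed

text \<open>A neighbourhood of the single point of M(x) contains, by shrinking, all measures
  available after some \<open>last_word x I\<close>, among them \<open>mu_inf\<close> of a past in
  \<open>D_g_inf X g\<close> with this final word.\<close>

lemma past_meas_in_closure:
  assumes x: "x \<in> D_meas_inf M"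
  shows "past_meas M x \<in> weak_star closure_of (mu_inf X g ` D_g_inf X g)"
  unfolding in_closure_of
proof (intro conjI allI impI)
  show "past_meas M x \<in> topspace weak_star"
    using past_set_D_meas_inf[OF x] past_set_prob[of M x] by simp
  fix T assume T: "past_meas M x \<in> T \<and> openin weak_star T"
  then have "past_set M x \<subseteq> T" using past_set_D_meas_inf[OF x] by simp
  then obtain I where I: "weak_star closure_of (trans_set (last_word x I) M) \<subseteq> T"
    using past_set_shrink[OF rc_prob rc_tc] T by blast
  have "x \<in> left_blocks X 0" using x unfolding D_meas_inf_iff X_def by (rule conjunct1)
  then have "admissible X (last_word x I)" by (simp add: left_blocks_iff[OF rc_subshift])
  from D_g_inf_dense[OF this] obtain y where y: "y \<in> D_g_inf X g" "last_word y I = last_word x I" by auto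
  have "mu_inf X g y \<in> past_set M y" by (simp add: past_set_generic[OF y(1)])
  then have "mu_inf X g y \<in> weak_star closure_of (trans_set (last_word y I) M)" unfolding past_set_def by blast
  then have "mu_inf X g y \<in> T" using I y(2) by auto
  then show "\<exists>\<nu>. \<nu> \<in> mu_inf X g ` D_g_inf X g \<and> \<nu> \<in> T" using y(1) by blast
qed

lemma vertex_set_of_g_of: "vertex_set_of X g = M"
proof
  have "mu_inf X g ` D_g_inf X g \<subseteq> M" using past_set_generic rc_past_subset by blast
  then have "weak_star closure_of (mu_inf X g ` D_g_inf X g) \<subseteq> weak_star closure_of M" by (rule closure_of_mono)
  then show "vertex_set_of X g \<subseteq> M" unfolding vertex_set_of_def rc_closed .
  have "weak_star closure_of (past_meas M ` D_meas_inf M) \<subseteq> vertex_set_of X g"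
    unfolding vertex_set_of_def
    by (rule closure_of_minimal) (use past_meas_in_closure in auto)
  then show "M \<subseteq> vertex_set_of X g" using M_subset_closure by blast
qed

end

subsection \<open>From g-functions to vertex sets and back\<close>

context
  fixes X :: "(int \<Rightarrow> 'a::finite) set" and g
  assumes X: "subshift X" and g: "residual_g_function X g"
begin

section \<open>The axioms of g in terms of final words\<close>

lemma residual_dom:
  "dom g \<subseteq> left_blocks X 0"
  "\<exists>G. gdelta_in (subtopology seq_topology (left_blocks X 0)) G \<and>
     subtopology seq_topology (left_blocks X 0) closure_of G = left_blocks X 0 \<and> G \<subseteq> dom g"
  using g by (simp_all add: residual_g_function_def residual_in_def)

lemma g_continuous_map: "continuous_map (prod_topology (subtopology seq_topology (dom g)) (discrete_topology UNIV))
      (top_of_set {0..1}) (\<lambda>(x, \<sigma>). gval g x \<sigma>)"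
  using g by (simp add: residual_g_function_def)

lemma g_bounds:
  assumes "x \<in> dom g"
  shows "0 \<le> gval g x s" "gval g x s \<le> 1"
proof -
  have "(case (x, s) of (x, \<sigma>) \<Rightarrow> gval g x \<sigma>) \<in> topspace (top_of_set {0..1})"
    by (rule funcset_mem[OF continuous_map_funspace[OF g_continuous_map]]) (use assms in simp)
  then show "0 \<le> gval g x s" "gval g x s \<le> 1" by simp_all
qed

lemma g_sum:
  assumes "x \<in> dom g"
  shows "(\<Sum>s | extend x [s] \<in> left_blocks X 0. gval g x s) = 1"
    and "extend x [s] \<notin> left_blocks X 0 \<Longrightarrow> gval g x s = 0"
  using g assms unfolding residual_g_function_def by (simp_all add: followers_iff[OF X])

lemma g_no_extension:
  assumes "y \<in> left_blocks X 0 - dom g"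
  shows "\<not> continuous_map (subtopology seq_topology (insert y (dom g)))
    (product_topology (\<lambda>_. euclideanreal) UNIV) ((gval g)(y := v))"
  using g assms unfolding residual_g_function_def by blast

text \<open>Condition (iii) in finite form: a past ending in \<open>w @ [s]\<close> is approximated
  by points (y,s) with positive g-value, and agreement on the last letters makes \<open>y\<close>
  end in \<open>w\<close>.\<close>

lemma g_support:
  assumes "admissible X (w @ [s])"
  shows "\<exists>y\<in>dom g. gval g y s > 0 \<and> extend y [s] \<in> left_blocks X 0 \<and> last_word y (length w) = w"
proof -
  obtain x where x: "x \<in> left_blocks X 0" "last_word x (length (w @ [s])) = w @ [s]"
    using ex_generic_past[OF X assms, of "\<lambda>_ _. True"] by (metis append_Nil assms)
  define S where "S = {extend x [\<alpha>] | x \<alpha>. x \<in> dom g \<and> [\<alpha>] \<in> followers X 1 x \<and> gval g x \<alpha> > 0}"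
  have "left_blocks X 1 = seq_topology closure_of S"
    using g unfolding residual_g_function_def S_def by blast
  then have "x \<in> seq_topology closure_of S" using x(1) left_blocks_0[OF X, of 1] by simp
  then obtain z where z: "z \<in> S" "last_word z (length (w @ [s])) = w @ [s]"
    using x(2) unfolding in_closure_last_word by metis
  from z(1) obtain y \<alpha> where y: "z = extend y [\<alpha>]" "y \<in> dom g" "[\<alpha>] \<in> followers X 1 y" "gval g y \<alpha> > 0"
    unfolding S_def by blast
  have "last_word y (length w) @ [\<alpha>] = w @ [s]"
    using z(2) last_word_extend[of y "[\<alpha>]" "length w"] by (simp add: y(1))
  then show ?thesis using y by (auto simp: followers_iff[OF X])
qed

lemma g_continuous:
  assumes x: "x \<in> dom g" and e: "e > 0"
  shows "\<exists>n. \<forall>z\<in>dom g. last_word z n = last_word x n \<longrightarrow> (\<forall>s. \<bar>gval g z s - gval g x s\<bar> < e)"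
proof -
  have "\<exists>n. \<forall>z\<in>dom g. last_word z n = last_word x n \<longrightarrow> \<bar>gval g z s - gval g x s\<bar> < e" for s
  proof -
    have "continuous_map (subtopology seq_topology (dom g))
        (prod_topology (subtopology seq_topology (dom g)) (discrete_topology UNIV)) (\<lambda>x. (x, s))"
      by (intro continuous_map_pairedI continuous_map_id[unfolded id_def]) simp
    then have "continuous_map (subtopology seq_topology (dom g)) (top_of_set {0..1})
        ((\<lambda>(x, \<sigma>). gval g x \<sigma>) \<circ> (\<lambda>x. (x, s)))"
      using g_continuous_map by (rule continuous_map_compose)
    then have "continuous_map (subtopology seq_topology (dom g)) euclideanreal (\<lambda>x. gval g x s)"
      by (simp add: o_def continuous_map_in_subtopology)
    then have "openin (subtopology seq_topology (dom g))
        {z \<in> topspace (subtopology seq_topology (dom g)). gval g z s \<in> ball (gval g x s) e}"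
      by (rule openin_continuous_map_preimage) simp
    then obtain U where U: "openin seq_topology U" "{z \<in> dom g. gval g z s \<in> ball (gval g x s) e} = U \<inter> dom g"
      by (auto simp: openin_subtopology)
    have "x \<in> {z \<in> dom g. gval g z s \<in> ball (gval g x s) e}" using x e by simp
    then have "x \<in> U" unfolding U(2) by blast
    then obtain n where n: "\<And>z. last_word z n = last_word x n \<Longrightarrow> z \<in> U"
      using U(1) unfolding openin_last_word by meson
    have "\<bar>gval g z s - gval g x s\<bar> < e" if "z \<in> dom g" "last_word z n = last_word x n" for z
    proof -
      have "z \<in> U \<inter> dom g" using n that by blast
      then have "gval g z s \<in> ball (gval g x s) e" unfolding U(2)[symmetric] by simp
      then show ?thesis by (simp add: dist_real_def abs_minus_commute)
    qed
    then show ?thesis by blast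
  qed
  then have "\<forall>s. \<exists>n. \<forall>z\<in>dom g. last_word z n = last_word x n \<longrightarrow> \<bar>gval g z s - gval g x s\<bar> < e" by blast
  from choice[OF this] obtain N where
    N: "\<And>s z. z \<in> dom g \<Longrightarrow> last_word z (N s) = last_word x (N s) \<Longrightarrow> \<bar>gval g z s - gval g x s\<bar> < e"
    by auto
  have "\<bar>gval g z s - gval g x s\<bar> < e" if z: "z \<in> dom g" "last_word z (Max (range N)) = last_word x (Max (range N))" for z s
  proof (rule N[OF z(1)])
    have le: "N s \<le> Max (range N)" by simp
    have "z i = x i" if "i < N s" for i
      using z(2) less_le_trans[OF that le] by (simp add: last_word_eq_iff del: Max_ge)
    then show "last_word z (N s) = last_word x (N s)" by (simp add: last_word_eq_iff)
  qed
  then show ?thesis by blast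
qed

section \<open>The measures attached to generic pasts\<close>

text \<open>All continuations of \<open>x\<close> in \<open>X\<close> lie in the domain of
  \<open>g\<close>, so the summation condition (i) can be used at each of them.\<close>

lemma consistent_word_prob:
  assumes x: "x \<in> D_g_inf X g"
  shows "consistent (word_prob X g x)"
proof -
  have dom: "extend x a \<in> dom g" if "extend x a \<in> left_blocks X 0" for a
    using x that by (simp add: D_g_inf_iff[OF X])
  have x_LB: "x \<in> left_blocks X 0" using x residual_dom(1) by (auto simp: D_g_inf_def)
  have nonneg: "0 \<le> word_prob X g x a" for a
  proof (induction a rule: rev_induct)
    case (snoc s a)
    have "0 \<le> (if extend x (a @ [s]) \<in> left_blocks X 0 then gval g (extend x a) s else 0)"
    proof (cases "extend x (a @ [s]) \<in> left_blocks X 0")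
      case True
      then have "extend x a \<in> left_blocks X 0"
        using left_blocks_prefix[OF X, of "extend x a" "[s]"] by (simp add: extend_append)
      then show ?thesis using g_bounds(1)[OF dom] by simp
    qed simp
    with snoc show ?case unfolding word_prob_snoc[OF X] by (rule mult_nonneg_nonneg)
  qed (simp add: word_prob_def)
  moreover have "(\<Sum>s\<in>UNIV. word_prob X g x (a @ [s])) = word_prob X g x a" for a
  proof (cases "extend x a \<in> left_blocks X 0")
    case True
    have "(\<Sum>s\<in>UNIV. word_prob X g x (a @ [s])) = word_prob X g x a *
        (\<Sum>s\<in>UNIV. if extend x (a @ [s]) \<in> left_blocks X 0 then gval g (extend x a) s else 0)"
      by (simp add: word_prob_snoc[OF X] sum_distrib_left)
    also have "(\<Sum>s\<in>UNIV. if extend x (a @ [s]) \<in> left_blocks X 0 then gval g (extend x a) s else 0) =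
        (\<Sum>s | extend (extend x a) [s] \<in> left_blocks X 0. gval g (extend x a) s)"
      by (simp add: sum.If_cases extend_append)
    also have "\<dots> = 1" by (rule g_sum(1)[OF dom[OF True]])
    finally show ?thesis by simp
  next
    case False
    then show ?thesis by (simp add: word_prob_snoc[OF X]) (simp add: word_prob_def)
  qed
  moreover have "word_prob X g x [] = 1" using x_LB by (simp add: word_prob_def)
  ultimately show ?thesis by (simp add: consistent_def)
qed

lemma mu_inf_cyl:
  assumes x: "x \<in> D_g_inf X g"
  shows "mu_inf X g x \<in> prob_measures" "cyl (mu_inf X g x) = word_prob X g x"
proof -
  obtain \<mu> where \<mu>: "\<mu> \<in> prob_measures" "cyl \<mu> = word_prob X g x"
    using ex_measure_cyl[OF consistent_word_prob[OF x]] by blast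
  have "mu_inf X g x = \<mu>" by (rule mu_inf_eqI[OF X \<mu>])
  with \<mu> show "mu_inf X g x \<in> prob_measures" "cyl (mu_inf X g x) = word_prob X g x" by simp_all
qed

lemma D_g_inf_extend:
  assumes x: "x \<in> D_g_inf X g" and a: "extend x a \<in> left_blocks X 0"
  shows "extend x a \<in> D_g_inf X g"
  using x a by (simp add: D_g_inf_iff[OF X] flip: extend_append)

lemma word_prob_append:
  assumes a: "extend x a \<in> left_blocks X 0"
  shows "word_prob X g x (a @ b) = word_prob X g x a * word_prob X g (extend x a) b"
proof (induction b rule: rev_induct)
  case Nil
  then show ?case using a by (simp add: word_prob_def)
next
  case (snoc s b)
  have "word_prob X g x (a @ b @ [s]) = word_prob X g x (a @ b) *
      (if extend x ((a @ b) @ [s]) \<in> left_blocks X 0 then gval g (extend x (a @ b)) s else 0)"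
    using word_prob_snoc[OF X, of g x "a @ b" s] by simp
  also have "\<dots> = word_prob X g x a * (word_prob X g (extend x a) b *
      (if extend (extend x a) (b @ [s]) \<in> left_blocks X 0 then gval g (extend (extend x a) b) s else 0))"
    by (simp add: snoc extend_append mult.assoc)
  also have "\<dots> = word_prob X g x a * word_prob X g (extend x a) (b @ [s])"
    by (simp only: word_prob_snoc[OF X])
  finally show ?case .
qed

lemma word_prob_letter:
  assumes x: "x \<in> D_g_inf X g"
  shows "word_prob X g x [s] = gval g x s"
proof -
  have "x \<in> dom g" using x by (simp add: D_g_inf_def)
  then show ?thesis using g_sum(2)[of x s] by (simp add: word_prob_def)
qed

lemma word_prob_pos_left_blocks: "word_prob X g x a > 0 \<Longrightarrow> extend x a \<in> left_blocks X 0"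
  by (simp add: word_prob_def split: if_splits)

text \<open>\<open>word_prob_append\<close> is multiplicativity along a path; dividing by the first
  factor leaves the values prescribed at (x,a).\<close>

lemma trans_meas_mu_inf:
  assumes x: "x \<in> D_g_inf X g" and pos: "cyl (mu_inf X g x) a > 0"
  shows "extend x a \<in> D_g_inf X g" "trans_meas a (mu_inf X g x) = mu_inf X g (extend x a)"
proof -
  have pos': "word_prob X g x a > 0" using pos by (simp add: mu_inf_cyl(2)[OF x])
  have a: "extend x a \<in> left_blocks X 0" by (rule word_prob_pos_left_blocks[OF pos'])
  show "extend x a \<in> D_g_inf X g" by (rule D_g_inf_extend[OF x a])
  have "cyl (trans_meas a (mu_inf X g x)) = word_prob X g (extend x a)"
    using pos' by (simp add: fun_eq_iff trans_meas(2)[OF mu_inf_cyl(1)[OF x] pos] mu_inf_cyl(2)[OF x] word_prob_append[OF a])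
  then show "trans_meas a (mu_inf X g x) = mu_inf X g (extend x a)"
    using trans_meas(1)[OF mu_inf_cyl(1)[OF x] pos] by (intro mu_inf_eqI[OF X, symmetric])
qed

text \<open>The dense G-delta set inside the domain is an intersection of relatively open sets
  \<open>U n\<close>. Prolonging a word along a point of it eventually forces every past of
  \<open>X\<close> with that ending into \<open>U n\<close>, which is the requirement
  \<open>R n\<close>.\<close>

lemma D_g_inf_dense_residual:
  assumes w: "admissible X w"
  shows "\<exists>x\<in>D_g_inf X g. last_word x (length w) = w"
proof -
  define LB where "LB = left_blocks X 0"
  obtain G where G: "gdelta_in (subtopology seq_topology LB) G"
     "subtopology seq_topology LB closure_of G = LB" "G \<subseteq> dom g"
    using residual_dom(2) unfolding LB_def by blast
  obtain U where U: "\<And>n::nat. openin (subtopology seq_topology LB) (U n)" "\<Inter> (range U) = G"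
    using G(1) unfolding gdelta_in_descending by blast
  define R where "R n u \<longleftrightarrow> (\<forall>x\<in>LB. last_word x (length u) = u \<longrightarrow> x \<in> U n)" for n u
  have "\<exists>c. admissible X (c @ u) \<and> R n (c @ u)" if u: "admissible X u" for n u
  proof -
    obtain y where y: "y \<in> LB" "last_word y (length u) = u"
      using ex_generic_past[OF X u, of "\<lambda>_ _. True"] unfolding LB_def by (metis append_Nil u)
    have "y \<in> subtopology seq_topology LB closure_of G" using y(1) G(2) by simp
    then have "y \<in> seq_topology closure_of G" by (rule subsetD[OF closure_of_subtopology_subset])
    then obtain z where z: "z \<in> G" "last_word z (length u) = u"
      unfolding in_closure_last_word using y(2) by metis
    have zLB: "z \<in> LB" using z(1) G(3) residual_dom(1) unfolding LB_def by blast
    obtain V where V: "openin seq_topology V" "U n = V \<inter> LB"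
      using U(1)[of n] unfolding openin_subtopology by blast
    have "z \<in> V" using z(1) U(2) V(2) by blast
    then obtain k where k: "\<And>y. last_word y k = last_word z k \<Longrightarrow> y \<in> V"
      using V(1) unfolding openin_last_word by meson
    obtain c where c: "last_word z (k + length u) = c @ u"
      using last_word_suffix[of "length u" "k + length u" z] z(2) by auto
    have len: "length (c @ u) = k + length u" unfolding c[symmetric] by simp
    have "x \<in> U n" if "x \<in> LB" "last_word x (length (c @ u)) = c @ u" for x
    proof -
      have "last_word x (k + length u) = last_word z (k + length u)" using that(2) unfolding len c .
      then have "last_word x k = last_word z k" by (simp add: last_word_eq_iff)
      then show ?thesis using k V(2) that(1) by blast
    qed
    then have "R n (c @ u)" unfolding R_def by blast
    moreover have "admissible X (c @ u)"
      unfolding c[symmetric] using zLB by (simp add: LB_def left_blocks_iff[OF X])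
    ultimately show ?thesis by blast
  qed
  from ex_generic_past_followers[OF X w, of R, OF this]
  obtain x where x: "x \<in> LB" "last_word x (length w) = w"
    and Rx: "\<And>a n. extend x a \<in> LB \<Longrightarrow> \<exists>k. R n (last_word (extend x a) k)" unfolding LB_def by blast
  have ext: "extend x a \<in> dom g" if a: "extend x a \<in> LB" for a
  proof -
    have "extend x a \<in> U n" for n
    proof -
      obtain k where "R n (last_word (extend x a) k)" using Rx[OF a] by blast
      then show ?thesis using a unfolding R_def by simp
    qed
    then show ?thesis using U(2) G(3) by blast
  qed
  have "x \<in> D_g_inf X g"
    unfolding D_g_inf_iff[OF X] using ext[of "[]"] x(1) ext unfolding LB_def by simp
  then show ?thesis using x(2) by blast
qed

text \<open>By (iii), the final letter of \<open>c @ [s]\<close> has positive \<open>g\<close>-value at some point of the cylinder of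
  pasts ending in \<open>c\<close>, hence by continuity on a smaller cylinder; the remaining letters of the word
  are treated first, so that this cylinder can be chosen inside the one obtained for them.\<close>

lemma word_prob_pos:
  assumes "admissible X (c @ a)"
  shows "\<exists>d. admissible X (d @ c) \<and>
    (\<forall>x\<in>D_g_inf X g. last_word x (length (d @ c)) = d @ c \<longrightarrow> word_prob X g x a > 0)"
  using assms
proof (induction a arbitrary: c)
  case Nil
  have "word_prob X g x [] > 0" if "x \<in> D_g_inf X g" for x
    using consistent_word_prob[OF that] by (simp add: consistent_def)
  then show ?case using Nil by (intro exI[of _ "[]"]) simp
next
  case (Cons s a)
  then have "admissible X ((c @ [s]) @ a)" by simp
  from Cons.IH[OF this] obtain d where d: "admissible X ((d @ c) @ [s])"
    and pos: "\<And>x. x \<in> D_g_inf X g \<Longrightarrow> last_word x (length (d @ c @ [s])) = d @ c @ [s] \<Longrightarrow> word_prob X g x a > 0"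
    by auto
  obtain y where y: "y \<in> dom g" "gval g y s > 0" "last_word y (length (d @ c)) = d @ c"
    using g_support[OF d] by blast
  \<comment> \<open>With \<open>gval g y s\<close> itself as the error, \<open>gval g z s\<close>
    stays positive.\<close>
  obtain n where n: "\<And>z. z \<in> dom g \<Longrightarrow> last_word z n = last_word y n \<Longrightarrow> \<bar>gval g z s - gval g y s\<bar> < gval g y s"
    using g_continuous[OF y(1,2)] by blast
  \<comment> \<open>The length covers both the \<open>n\<close> letters needed for continuity at
    \<open>y\<close> and the ending \<open>d @ c\<close>.\<close>
  obtain e where e: "last_word y (n + length (d @ c)) = e @ d @ c"
    using last_word_suffix[of "length (d @ c)" "n + length (d @ c)" y] y(3) by auto
  have len: "length (e @ d @ c) = n + length (d @ c)" unfolding e[symmetric] by simp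
  have "word_prob X g x (s # a) > 0"
    if x: "x \<in> D_g_inf X g" and xw: "last_word x (length (e @ d @ c)) = e @ d @ c" for x
  proof -
    have xdom: "x \<in> dom g" using x by (simp add: D_g_inf_def)
    have xy: "last_word x (n + length (d @ c)) = last_word y (n + length (d @ c))" using xw unfolding len e .
    then have "last_word x n = last_word y n" by (simp add: last_word_eq_iff)
    then have gpos: "gval g x s > 0" using n[OF xdom] by fastforce
    then have ext: "extend x [s] \<in> left_blocks X 0" using g_sum(2)[OF xdom, of s] by auto
    have "last_word x (length (d @ c)) = last_word y (length (d @ c))"
      using xy by (simp add: last_word_eq_iff)
    then have "last_word (extend x [s]) (length (d @ c @ [s])) = d @ c @ [s]"
      using last_word_extend[of x "[s]" "length (d @ c)"] y(3) by simp
    then have "word_prob X g (extend x [s]) a > 0" by (intro pos D_g_inf_extend x ext)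
    then show ?thesis
      using word_prob_append[OF ext, of a] gpos by (simp add: word_prob_letter[OF x])
  qed
  moreover have "admissible X (e @ d @ c)"
    unfolding e[symmetric] using y(1) residual_dom(1) left_blocks_iff[OF X] by blast
  ultimately show ?case by (intro exI[of _ "e @ d"]) auto
qed

section \<open>The vertex set of g and the recovery of g\<close>

lemma mu_inf_image_prob: "mu_inf X g ` D_g_inf X g \<subseteq> prob_measures"
  using mu_inf_cyl(1) by blast

lemma vertex_set_prob: "vertex_set_of X g \<subseteq> prob_measures"
  unfolding vertex_set_of_def by (rule closure_of_prob)

text \<open>\<open>word_prob_pos\<close> and density of generic pasts give a measure charging an
  admissible \<open>a\<close>. Conversely, positivity passes from a limit to some
  \<open>mu_inf\<close>, which charges only words that continue its past within
  \<open>X\<close>.\<close>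

lemma vertex_set_admissible: "admissible X a \<longleftrightarrow> (\<exists>\<mu>\<in>vertex_set_of X g. cyl \<mu> a > 0)"
proof
  assume "admissible X a"
  then obtain d where d: "admissible X d"
    "\<And>x. x \<in> D_g_inf X g \<Longrightarrow> last_word x (length d) = d \<Longrightarrow> word_prob X g x a > 0"
    using word_prob_pos[of "[]" a] by auto
  obtain x where x: "x \<in> D_g_inf X g" "last_word x (length d) = d" using D_g_inf_dense_residual[OF d(1)] by blast
  have "mu_inf X g x \<in> vertex_set_of X g"
    unfolding vertex_set_of_def using subset_closure_of[OF mu_inf_image_prob] x(1) by blast
  then show "\<exists>\<mu>\<in>vertex_set_of X g. cyl \<mu> a > 0"
    by (rule bexI[rotated]) (simp add: mu_inf_cyl(2)[OF x(1)] d(2)[OF x])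
next
  assume "\<exists>\<mu>\<in>vertex_set_of X g. cyl \<mu> a > 0"
  then obtain x where x: "x \<in> D_g_inf X g" "cyl (mu_inf X g x) a > 0"
    using closure_pos[OF mu_inf_image_prob] unfolding vertex_set_of_def by blast
  then have "extend x a \<in> left_blocks X 0" using word_prob_pos_left_blocks mu_inf_cyl(2)[OF x(1)] by simp
  then have "admissible X (last_word (extend x a) (length a + 0))" unfolding left_blocks_iff[OF X] by blast
  then show "admissible X a" unfolding last_word_extend by (simp add: last_word_def)
qed

lemma presented_vertex_set: "presented_subshift (vertex_set_of X g) = X"
  by (rule presented_subshift_eqI[OF X vertex_set_admissible])

lemma trans_set_vertex_set:
  "trans_set w (vertex_set_of X g) \<subseteq>
    weak_star closure_of (mu_inf X g ` {z \<in> D_g_inf X g. last_word z (length w) = w})"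
proof -
  have "trans_set w (vertex_set_of X g) \<subseteq> weak_star closure_of (trans_set w (mu_inf X g ` D_g_inf X g))"
    unfolding vertex_set_of_def by (rule trans_set_closure[OF mu_inf_image_prob])
  also have "\<dots> \<subseteq> weak_star closure_of (mu_inf X g ` {z \<in> D_g_inf X g. last_word z (length w) = w})"
  proof (rule closure_of_mono, rule subsetI)
    fix \<nu> assume "\<nu> \<in> trans_set w (mu_inf X g ` D_g_inf X g)"
    then obtain x where x: "x \<in> D_g_inf X g" "cyl (mu_inf X g x) w > 0" "\<nu> = trans_meas w (mu_inf X g x)"
      by (auto elim: trans_setE)
    have "last_word (extend x w) (length w) = w"
      using last_word_extend[of x w 0] by (simp add: last_word_def)
    then show "\<nu> \<in> mu_inf X g ` {z \<in> D_g_inf X g. last_word z (length w) = w}"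
      unfolding x(3) trans_meas_mu_inf(2)[OF x(1,2)] using trans_meas_mu_inf(1)[OF x(1,2)] by blast
  qed
  finally show ?thesis .
qed

lemma transition_complete_vertex_set: "transition_complete (vertex_set_of X g)"
  unfolding transition_complete_def
proof
  fix s
  have "weak_star closure_of (mu_inf X g ` {z \<in> D_g_inf X g. last_word z (length [s]) = [s]}) \<subseteq> vertex_set_of X g"
    unfolding vertex_set_of_def by (rule closure_of_mono) blast
  then show "trans_set [s] (vertex_set_of X g) \<subseteq> vertex_set_of X g" using trans_set_vertex_set by blast
qed

lemma past_set_vertex_set_value:
  assumes x: "x \<in> dom g" and \<mu>: "\<mu> \<in> past_set (vertex_set_of X g) x"
  shows "cyl \<mu> [s] = gval g x s"
proof -
  have "\<bar>cyl \<mu> [s] - gval g x s\<bar> \<le> e" if e: "e > 0" for e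
  proof -
    obtain n where n: "\<And>z. z \<in> dom g \<Longrightarrow> last_word z n = last_word x n \<Longrightarrow> \<bar>gval g z s - gval g x s\<bar> < e"
      using g_continuous[OF x e] by blast
    define S where "S = mu_inf X g ` {z \<in> D_g_inf X g. last_word z n = last_word x n}"
    have S: "S \<subseteq> prob_measures" unfolding S_def using mu_inf_image_prob by blast
    have "trans_set (last_word x n) (vertex_set_of X g) \<subseteq> weak_star closure_of S"
      using trans_set_vertex_set[of "last_word x n"] unfolding S_def by simp
    then have "weak_star closure_of (trans_set (last_word x n) (vertex_set_of X g)) \<subseteq> weak_star closure_of S"
      by (rule closure_of_minimal) simp
    then have "\<mu> \<in> weak_star closure_of S" using \<mu> unfolding past_set_def by blast
    then obtain f where f: "\<And>n. f n \<in> S" "\<And>a. (\<lambda>n. cyl (f n) a) \<longlonglongrightarrow> cyl \<mu> a"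
      unfolding in_closure_weak_star[OF S] by blast
    have "\<bar>cyl (f k) [s] - gval g x s\<bar> \<le> e" for k
    proof -
      obtain z where z: "z \<in> D_g_inf X g" "last_word z n = last_word x n" "f k = mu_inf X g z"
        using f(1)[of k] unfolding S_def by blast
      have "z \<in> dom g" using z(1) by (simp add: D_g_inf_def)
      from n[OF this z(2)] show ?thesis
        by (simp add: z(3) mu_inf_cyl(2)[OF z(1)] word_prob_letter[OF z(1)])
    qed
    moreover have "(\<lambda>n. \<bar>cyl (f n) [s] - gval g x s\<bar>) \<longlonglongrightarrow> \<bar>cyl \<mu> [s] - gval g x s\<bar>"
      by (intro tendsto_intros f(2))
    ultimately show ?thesis by (intro LIMSEQ_le_const2) auto
  qed
  then have "\<bar>cyl \<mu> [s] - gval g x s\<bar> \<le> 0" by - (rule field_le_epsilon, simp)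
  then show ?thesis by simp
qed

lemma past_set_vertex_set_nonempty:
  assumes "x \<in> left_blocks X 0"
  shows "past_set (vertex_set_of X g) x \<noteq> {}"
proof (rule past_set_nonempty[OF vertex_set_prob transition_complete_vertex_set])
  fix I
  have "admissible X (last_word x I)" using assms by (simp add: left_blocks_iff[OF X])
  then show "\<exists>\<mu>\<in>vertex_set_of X g. cyl \<mu> (last_word x I) > 0" by (simp add: vertex_set_admissible)
qed

text \<open>If \<open>x \<in> D_meas M 1\<close> were not in \<open>dom g\<close>, the common value of the one-letter marginals would
  extend \<open>g\<close> continuously to \<open>x\<close>, contrary to (ii).\<close>

lemma D_meas_vertex_set: "D_meas (vertex_set_of X g) 1 = dom g"
proof
  let ?M = "vertex_set_of X g"
  show "dom g \<subseteq> D_meas ?M 1"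
  proof
    fix x assume x: "x \<in> dom g"
    show "x \<in> D_meas ?M 1"
      unfolding D_meas_1_iff presented_vertex_set
      using x residual_dom(1) past_set_vertex_set_value[OF x] by auto
  qed
  show "D_meas ?M 1 \<subseteq> dom g"
  proof
    fix x assume x: "x \<in> D_meas ?M 1"
    then have xLB: "x \<in> left_blocks X 0"
      unfolding D_meas_1_iff presented_vertex_set by (rule conjunct1)
    then obtain \<nu> where \<nu>: "\<nu> \<in> past_set ?M x" using past_set_vertex_set_nonempty by blast
    define v where "v s = cyl \<nu> [s]" for s
    have v: "cyl \<mu> [s] = v s" if "\<mu> \<in> past_set ?M x" for \<mu> s
      using x that \<nu> unfolding v_def D_meas_1_iff by blast
    \<comment> \<open>Shrinking at \<open>x\<close> confines M(y) to measures with letter marginals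
      near \<open>v\<close> as soon as \<open>y\<close> shares a long final word with
      \<open>x\<close>; for \<open>y\<close> in the domain these marginals are the values of
      \<open>g\<close>.\<close>
    have near: "\<exists>n. \<forall>y\<in>dom g. last_word y n = last_word x n \<longrightarrow> (\<forall>s. \<bar>gval g y s - v s\<bar> < e)"
      if e: "e > 0" for e
    proof -
      define W where "W = {\<mu> \<in> prob_measures. \<forall>s. \<bar>cyl \<mu> [s] - v s\<bar> < e}"
      have "past_set ?M x \<subseteq> W" unfolding W_def using v e past_set_prob by fastforce
      moreover have "openin weak_star W" unfolding W_def by (rule openin_weak_star_letters)
      ultimately obtain n where n: "weak_star closure_of (trans_set (last_word x n) ?M) \<subseteq> W"
        using past_set_shrink[OF vertex_set_prob transition_complete_vertex_set] by blast
      have "\<bar>gval g y s - v s\<bar> < e" if y: "y \<in> dom g" "last_word y n = last_word x n" for y s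
      proof -
        obtain \<mu> where \<mu>: "\<mu> \<in> past_set ?M y"
          using past_set_vertex_set_nonempty y(1) residual_dom(1) by blast
        then have "\<mu> \<in> weak_star closure_of (trans_set (last_word y n) ?M)" unfolding past_set_def by blast
        then have "\<mu> \<in> W" using n y(2) by auto
        then have "\<bar>cyl \<mu> [s] - v s\<bar> < e" unfolding W_def by blast
        then show ?thesis by (simp add: past_set_vertex_set_value[OF y(1) \<mu>])
      qed
      then show ?thesis by blast
    qed
    show "x \<in> dom g"
    proof (rule ccontr)
      assume xg: "x \<notin> dom g"
      define h where "h = (gval g)(x := v)"
      have cont: "\<exists>n. \<forall>y\<in>insert x (dom g). last_word y n = last_word z n \<longrightarrow> (\<forall>s. \<bar>h y s - h z s\<bar> < e)"
        if z: "z \<in> insert x (dom g)" and e: "e > 0" for z e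
      proof (cases "z = x")
        case True
        obtain n where n: "\<And>y s. y \<in> dom g \<Longrightarrow> last_word y n = last_word x n \<Longrightarrow> \<bar>gval g y s - v s\<bar> < e"
          using near[OF e] by blast
        have "\<bar>h y s - h z s\<bar> < e" if "y \<in> insert x (dom g)" "last_word y n = last_word z n" for y s
          using n[of y s] that e True xg by (cases "y = x") (auto simp: h_def)
        then show ?thesis by blast
      next
        case False
        then have zg: "z \<in> dom g" using z by simp
        obtain n where n: "\<And>y s. y \<in> dom g \<Longrightarrow> last_word y n = last_word z n \<Longrightarrow> \<bar>gval g y s - gval g z s\<bar> < e"
          using g_continuous[OF zg e] by blast
        \<comment> \<open>Agreement with \<open>z\<close> at position \<open>i\<close> excludes the
          point \<open>x\<close>, the only one where \<open>h\<close> is not given by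
          \<open>g\<close>.\<close>
        obtain i where i: "x i \<noteq> z i" using False by (metis ext)
        have "\<bar>h y s - h z s\<bar> < e" if y: "y \<in> insert x (dom g)" "last_word y (max n (Suc i)) = last_word z (max n (Suc i))" for y s
        proof -
          have agree: "y j = z j" if "j < max n (Suc i)" for j using y(2) that by (simp add: last_word_eq_iff)
          have "y i = z i" by (rule agree) simp
          then have "y \<noteq> x" using i by auto
          moreover have "last_word y n = last_word z n" using agree by (simp add: last_word_eq_iff)
          ultimately show ?thesis using n[of y s] y(1) False by (auto simp: h_def)
        qed
        then show ?thesis by blast
      qed
      have "continuous_map (subtopology seq_topology (insert x (dom g))) euclideanreal (\<lambda>y. h y s)" for s
        unfolding continuous_map_def
      proof (intro conjI allI impI)
        fix V :: "real set" assume "openin euclideanreal V"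
        then have V: "open V" by simp
        \<comment> \<open>The union of the cylinders on whose domain points \<open>h\<close> at
          \<open>s\<close> stays in \<open>V\<close>: open in the full space, it cuts out the
          preimage of \<open>V\<close>.\<close>
        define U where "U = {u. \<exists>n. \<forall>y\<in>insert x (dom g). last_word y n = last_word u n \<longrightarrow> h y s \<in> V}"
        have "openin seq_topology U"
          unfolding openin_last_word
        proof
          fix u assume "u \<in> U"
          then obtain n where n: "\<forall>y\<in>insert x (dom g). last_word y n = last_word u n \<longrightarrow> h y s \<in> V"
            unfolding U_def by blast
          have "y \<in> U" if "last_word y n = last_word u n" for y
            unfolding U_def mem_Collect_eq that[symmetric] by (rule exI[of _ n]) (use n that in simp)
          then show "\<exists>n. \<forall>y. last_word y n = last_word u n \<longrightarrow> y \<in> U" by blast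
        qed
        moreover have "{y \<in> insert x (dom g). h y s \<in> V} = U \<inter> insert x (dom g)"
        proof (intro equalityI subsetI)
          fix z assume z: "z \<in> {y \<in> insert x (dom g). h y s \<in> V}"
          then obtain e where e: "e > 0" "\<And>r. \<bar>r - h z s\<bar> < e \<Longrightarrow> r \<in> V"
            using V unfolding open_dist dist_real_def by blast
          obtain n where "\<forall>y\<in>insert x (dom g). last_word y n = last_word z n \<longrightarrow> (\<forall>s. \<bar>h y s - h z s\<bar> < e)"
            using cont[OF _ e(1), of z] z by blast
          then have "z \<in> U" unfolding U_def using e(2) by blast
          then show "z \<in> U \<inter> insert x (dom g)" using z by blast
        next
          fix z assume "z \<in> U \<inter> insert x (dom g)"
          then show "z \<in> {y \<in> insert x (dom g). h y s \<in> V}" unfolding U_def by blast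
        qed
        ultimately show "openin (subtopology seq_topology (insert x (dom g)))
            {y \<in> topspace (subtopology seq_topology (insert x (dom g))). h y s \<in> V}"
          by (auto simp: openin_subtopology)
      qed simp
      then have "continuous_map (subtopology seq_topology (insert x (dom g)))
          (product_topology (\<lambda>_. euclideanreal) UNIV) h"
        by (simp add: continuous_map_componentwise_UNIV)
      then show False using g_no_extension[of x v] xLB xg unfolding h_def by blast
    qed
  qed
qed

lemma g_of_vertex_set: "g_of (vertex_set_of X g) = g"
proof
  let ?M = "vertex_set_of X g"
  fix x
  show "g_of ?M x = g x"
  proof (cases "x \<in> dom g")
    case True
    then obtain \<mu> where \<mu>: "\<mu> \<in> past_set ?M x" using past_set_vertex_set_nonempty residual_dom(1) by blast
    have "gval (g_of ?M) x s = gval g x s" for s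
      using g_of_value[OF True[folded D_meas_vertex_set] \<mu>, of s] past_set_vertex_set_value[OF True \<mu>, of s]
      by simp
    then have "gval (g_of ?M) x = gval g x" by blast
    moreover have "x \<in> dom (g_of ?M)" unfolding dom_g_of D_meas_vertex_set by (rule True)
    ultimately show ?thesis using True by (metis domIff option.exhaust_sel)
  next
    case False
    then have "x \<notin> dom (g_of ?M)" unfolding dom_g_of D_meas_vertex_set .
    then show ?thesis using False by (simp add: domIff)
  qed
qed

end

theorem proposition4p5:
  shows "(\<forall>(X :: (int \<Rightarrow> 'a::finite) set) g.
            subshift X \<and> property_D X \<and> residual_g_function X g \<longrightarrow>
            g_of (vertex_set_of X g) = g) \<and>
         (\<forall>M :: (nat \<Rightarrow> 'a) measure set.
            residually_contractive M \<longrightarrow>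
            vertex_set_of (presented_subshift M) (g_of M) = M)"
  using g_of_vertex_set vertex_set_of_g_of by blast

end
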